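(* Let $B\subset\mathbb R^8$ be a bounded domain with $C^3$ boundary and let $(B^h)_{h>0}$, $B^h\subset\mathbb Z^8_h$, satisfy $B=B^h+O(h^2)$. Then for every $f\in C^3(\overline B,\mathbb O)$ with $Df=0$ in $B$ there exist functions $f^h:B^h\to\mathbb O$ ($h>0$) such that $D^hf^h(x)=0$ for every $x\in(B^h)^\circ$ and $$\lim_{h\to0^+}\ \max_{x\in B^h\cap B}|f(x)-f^h(x)|=0.$$
   Context: $\mathbb O$ is the real octonion algebra with basis $\mathbf e_0=1,\dots,\mathbf e_7$, identified with $\mathbb R^8$; $|\cdot|$ is the Euclidean norm. $Df=\sum_{l=0}^7\mathbf e_l\,\partial f/\partial x_l$. For $h>0$, $\mathbb Z^8_h=(h\mathbb Z)^8$, $e_0,\dots,e_7$ are the standard unit vectors, $D^hf(x)=\sum_{l=0}^7\mathbf e_l\frac{f(x+he_l)-f(x-he_l)}{2h}$. For $A\subset\mathbb Z^8_h$: $N(x)=\{x,x\pm he_0,\dots,x\pm he_7\}$, $\partial A=\{x\in\mathbb Z^8_h:\ N(x)\cap A\neq\emptyset,\ N(x)\cap(\mathbb Z^8_h\setminus A)\neq\emptyset\}$, $A^\circ=A\setminus\partial A$. A family $(B^h)_{h>0}$ with $B^h\subset\mathbb Z^8_h$ converges to a bounded domain $B\subset\mathbb R^8$ if, as $h\to0^+$, $\max_{\alpha\in\partial B}\min_{\beta\in\partial B^h}\|\alpha-\beta\|\to0$, $\max_{\alpha\in\partial B^h}\min_{\beta\in\partial B}\|\alpha-\beta\|\to0$,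 $\max_{\alpha\in\overline B}\min_{\beta\in B^h}\|\alpha-\beta\|\to0$, and $\max_{\alpha\in B^h}\min_{\beta\in\overline B}\|\alpha-\beta\|\to0$ (topological $\partial B,\overline B$ in $\mathbb R^8$; discrete $\partial B^h$). We write $B=B^h+O(h^2)$ if $(B^h)$ converges to $B$ and in addition $h^8\,\#(B^h\setminus B)=O(h^2)$ as $h\to0^+$. *)

theory Defs
  imports "HOL-Analysis.Analysis" "HOL-Library.Landau_Symbols"
begin

text \<open>R^8 and the octonions are both modelled by real^8; index l (0..7) corresponds to
  the component (of_nat l :: 8).\<close>

definition ebas :: "nat \<Rightarrow> real^8" where
  "ebas l = axis (of_nat l :: 8) 1"

definition ocomp :: "real^8 \<Rightarrow> nat \<Rightarrow> real" where
  "ocomp x i = x $ (of_nat i :: 8)"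

text \<open>Fano-plane convention: e_i e_(i+1) = e_(i+3), indices mod 7 in 1..7.\<close>
definition fano :: "(nat \<times> nat \<times> nat) list" where
  "fano = [(1,2,4),(2,3,5),(3,4,6),(4,5,7),(5,6,1),(6,7,2),(7,1,3)]"

definition fano_pos :: "nat \<Rightarrow> nat \<Rightarrow> nat \<Rightarrow> bool" where
  "fano_pos i j k = (\<exists>(a,b,c)\<in>set fano. (i,j,k) \<in> {(a,b,c),(b,c,a),(c,a,b)})"

text \<open>e_i e_j = s e_k, returned as (s,k).\<close>
definition bmult :: "nat \<Rightarrow> nat \<Rightarrow> real \<times> nat" where
  "bmult i j =
     (if i = 0 then (1, j)
      else if j = 0 then (1, i)
      else if i = j then (-1, 0)
      else if (\<exists>k. fano_pos i j k) then (1, THE k. fano_pos i j k)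
      else (-1, THE k. fano_pos j i k))"

definition omult :: "real^8 \<Rightarrow> real^8 \<Rightarrow> real^8" where
  "omult p q = (\<Sum>i<8. \<Sum>j<8. (fst (bmult i j) * ocomp p i * ocomp q j) *\<^sub>R ebas (snd (bmult i j)))"

definition pd :: "nat \<Rightarrow> (real^8 \<Rightarrow> 'b::real_normed_vector) \<Rightarrow> real^8 \<Rightarrow> 'b" where
  "pd l f x = vector_derivative (\<lambda>t. f (x + t *\<^sub>R ebas l)) (at 0)"

text \<open>Ck k U S f: f is C^k on the open set U, with all partial derivatives of order
  \<le> k extending continuously to S (U \<subseteq> S). For U = B, S = closure B this is C^k(closure B).\<close>
fun Ck :: "nat \<Rightarrow> (real^8) set \<Rightarrow> (real^8) set \<Rightarrow> (real^8 \<Rightarrow> 'b::real_normed_vector) \<Rightarrow> bool" where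
  "Ck 0 U S f = continuous_on S f"
| "Ck (Suc k) U S f = (continuous_on S f \<and>
     (\<forall>l<8. \<exists>g. (\<forall>x\<in>U. ((\<lambda>t. f (x + t *\<^sub>R ebas l)) has_vector_derivative g x) (at 0)) \<and> Ck k U S g))"

definition C3_domain :: "(real^8) set \<Rightarrow> bool" where
  "C3_domain B \<longleftrightarrow> open B \<and> connected B \<and> bounded B \<and> B \<noteq> {} \<and>
     (\<forall>p\<in>frontier B. \<exists>r>0. \<exists>\<phi>::real^8 \<Rightarrow> real. Ck 3 UNIV UNIV \<phi> \<and>
        (\<exists>\<phi>'. (\<phi> has_derivative \<phi>') (at p) \<and> \<phi>' \<noteq> (\<lambda>_. 0)) \<and>
        B \<inter> ball p r = {x \<in> ball p r. \<phi> x < 0})"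

definition Dirac :: "(real^8 \<Rightarrow> real^8) \<Rightarrow> real^8 \<Rightarrow> real^8" where
  "Dirac f x = (\<Sum>l<8. omult (ebas l) (pd l f x))"

definition lattice :: "real \<Rightarrow> (real^8) set" where
  "lattice h = {x. \<forall>i. \<exists>k::int. x $ i = h * of_int k}"

definition Dh :: "real \<Rightarrow> (real^8 \<Rightarrow> real^8) \<Rightarrow> real^8 \<Rightarrow> real^8" where
  "Dh h g x = (\<Sum>l<8. omult (ebas l) ((1 / (2 * h)) *\<^sub>R (g (x + h *\<^sub>R ebas l) - g (x - h *\<^sub>R ebas l))))"

definition nbhd :: "real \<Rightarrow> real^8 \<Rightarrow> (real^8) set" where
  "nbhd h x = insert x ((\<lambda>l. x + h *\<^sub>R ebas l) ` {..<8} \<union> (\<lambda>l. x - h *\<^sub>R ebas l) ` {..<8})"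

definition dbd :: "real \<Rightarrow> (real^8) set \<Rightarrow> (real^8) set" where
  "dbd h A = {x \<in> lattice h. nbhd h x \<inter> A \<noteq> {} \<and> nbhd h x \<inter> (lattice h - A) \<noteq> {}}"

definition dint :: "real \<Rightarrow> (real^8) set \<Rightarrow> (real^8) set" where
  "dint h A = A - dbd h A"

definition disc_converges :: "(real \<Rightarrow> (real^8) set) \<Rightarrow> (real^8) set \<Rightarrow> bool" where
  "disc_converges Bh B \<longleftrightarrow> (\<forall>\<epsilon>>0. eventually (\<lambda>h.
      (\<forall>a\<in>frontier B. \<exists>b\<in>dbd h (Bh h). dist a b < \<epsilon>) \<and>
      (\<forall>a\<in>dbd h (Bh h). \<exists>b\<in>frontier B. dist a b < \<epsilon>) \<and>
      (\<forall>a\<in>closure B. \<exists>b\<in>Bh h. dist a b < \<epsilon>) \<and>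
      (\<forall>a\<in>Bh h. \<exists>b\<in>closure B. dist a b < \<epsilon>)) (at_right 0))"

definition approx_O2 :: "(real \<Rightarrow> (real^8) set) \<Rightarrow> (real^8) set \<Rightarrow> bool" where
  "approx_O2 Bh B \<longleftrightarrow> disc_converges Bh B \<and>
     (\<lambda>h. h ^ 8 * real (card (Bh h - B))) \<in> O[at_right 0](\<lambda>h. h ^ 2)"

end

(* Translate f inwards along a C^1 vector field that points into B: F(x) = f(x + \<delta> V(x)) is
   defined on a neighbourhood of the closure of B, is uniformly close to f, and D F is O(\<delta>) there.
   Hence D^h F is uniformly small on B^h for small h, and it remains to remove D^h F with a right
   inverse of D^h whose sup norm is bounded independently of h.  No fundamental solution is needed
   for this: D^h composed with its conjugate is the Laplacian of step 2h, the discrete Poisson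
   equation is solved below a quadratic barrier, and first differences of its solution are
   bounded by the maximum principle after an odd reflection. *)
theory Submission
  imports Defs
begin

subsection \<open>Octonion multiplication\<close>

text \<open>Octonion multiplication is not associative, so it is not automatic that D^h and its
  conjugate compose to a scalar operator. Only left multiplications by basis elements are ever
  composed, and these obey the Clifford relations, which are read off the multiplication table. The
  sets B^h are tied to B only through Hausdorff distances and may stick out of the closure of B,
  where f prescribes nothing. The smallness of D^h F therefore has to hold on a full neighbourhood
  of the closure, and the translation inwards provides this. Functions live on all of R^8 and
  difference equations are imposed at every real point of a ball. Such an equation splits into
  independent copies on translated lattices, so translations, reflections, balls and boxes can be
  used without lattice bookkeeping. The price is that the maximum principle works with infima that
  need not be attained. For a fixed \<delta> the resulting error is small but does not tend to 0. A
  near-optimal choice for each h merges the constructions for different error levels into one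
  family.\<close>

lemma bij_of_nat_8: "bij_betw (of_nat :: nat \<Rightarrow> 8) {..<8} UNIV"
proof -
  have e: "{..<8::nat} = {0,1,2,3,4,5,6,7}" by auto
  have "inj_on (of_nat :: nat \<Rightarrow> 8) {..<8}"
    unfolding e by (simp add: inj_on_def)
  moreover have "card (UNIV :: 8 set) = 8" by simp
  ultimately show ?thesis
    by (metis bij_betw_def card_image card_lessThan card_subset_eq finite subset_UNIV)
qed

lemma sum_of_nat_8: "(\<Sum>l<8. P (of_nat l :: 8)) = (\<Sum>i\<in>UNIV. P i)"
  using sum.reindex_bij_betw[OF bij_of_nat_8] .

lemma ocomp_ebas: "i < 8 \<Longrightarrow> j < 8 \<Longrightarrow> ocomp (ebas i) j = (if i = j then 1 else 0)"
  using bij_of_nat_8 by (auto simp: ocomp_def ebas_def axis_def bij_betw_def inj_on_def)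

lemma ebas_expand: "(\<Sum>l<8. ocomp x l *\<^sub>R ebas l) = x"
  using sum_of_nat_8[of "\<lambda>i. (x $ i) *\<^sub>R axis i (1::real)"]
  by (simp add: ocomp_def ebas_def basis_expansion[of x, unfolded scalar_mult_eq_scaleR])

lemma fano_pos_iff: "fano_pos i j k \<longleftrightarrow>
  (i,j,k) \<in> {(1,2,4),(2,3,5),(3,4,6),(4,5,7),(5,6,1),(6,7,2),(7,1,3),
    (2,4,1),(3,5,2),(4,6,3),(5,7,4),(6,1,5),(7,2,6),(1,3,7),
    (4,1,2),(5,2,3),(6,3,4),(7,4,5),(1,5,6),(2,6,7),(3,7,1)}"
  unfolding fano_pos_def fano_def by auto

text \<open>Both \<open>THE\<close> terms in \<open>bmult\<close> can be evaluated because an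
  ordered pair starts at most one oriented triple and its reversal then starts none. This is checked
  on the 21 triples.\<close>

lemma bmult_fano:
  assumes "fano_pos i j k"
  shows "bmult i j = (1, k)" "bmult j i = (-1, k)"
proof -
  have u: "fano_pos i j = (\<lambda>k'. k' = k)" and n: "fano_pos j i = (\<lambda>_. False)" and d: "i \<noteq> j" "i \<noteq> 0" "j \<noteq> 0"
    using assms[unfolded fano_pos_iff]
    by - (simp only: insert_iff empty_iff prod.inject; elim disjE conjE; simp add: fun_eq_iff fano_pos_iff; fail)+
  show "bmult i j = (1, k)" "bmult j i = (-1, k)"
    using d by (simp_all add: bmult_def u n)
qed

lemma bmult_unit: "bmult 0 j = (1, j)" "bmult i 0 = (1, i)" "i \<noteq> 0 \<Longrightarrow> bmult i i = (-1, 0)"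
  by (simp_all add: bmult_def)

lemma omult_linear: "linear (omult p)"
  unfolding omult_def ocomp_def
  by (rule linearI) (simp_all add: algebra_simps sum.distrib scaleR_sum_right)

lemma omult_ebas:
  assumes "i < 8" "j < 8"
  shows "omult (ebas i) (ebas j) = fst (bmult i j) *\<^sub>R ebas (snd (bmult i j))"
proof -
  have "omult (ebas i) (ebas j) = (\<Sum>a<8. \<Sum>b<8. (if i = a \<and> j = b then fst (bmult i j) *\<^sub>R ebas (snd (bmult i j)) else 0))"
    unfolding omult_def using assms by (intro sum.cong refl) (auto simp: ocomp_ebas)
  also have "\<dots> = (\<Sum>a<8. if i = a then (\<Sum>b<8. if j = b then fst (bmult i j) *\<^sub>R ebas (snd (bmult i j)) else 0) else 0)"
    by (intro sum.cong refl) auto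
  also have "\<dots> = fst (bmult i j) *\<^sub>R ebas (snd (bmult i j))" using assms by simp
  finally show ?thesis .
qed

lemma bmult_table:
  "bmult 1 2 = (1,4)" "bmult 2 1 = (-1,4)"
  "bmult 2 4 = (1,1)" "bmult 4 2 = (-1,1)"
  "bmult 4 1 = (1,2)" "bmult 1 4 = (-1,2)"
  "bmult 2 3 = (1,5)" "bmult 3 2 = (-1,5)"
  "bmult 3 5 = (1,2)" "bmult 5 3 = (-1,2)"
  "bmult 5 2 = (1,3)" "bmult 2 5 = (-1,3)"
  "bmult 3 4 = (1,6)" "bmult 4 3 = (-1,6)"
  "bmult 4 6 = (1,3)" "bmult 6 4 = (-1,3)"
  "bmult 6 3 = (1,4)" "bmult 3 6 = (-1,4)"
  "bmult 4 5 = (1,7)" "bmult 5 4 = (-1,7)"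
  "bmult 5 7 = (1,4)" "bmult 7 5 = (-1,4)"
  "bmult 7 4 = (1,5)" "bmult 4 7 = (-1,5)"
  "bmult 5 6 = (1,1)" "bmult 6 5 = (-1,1)"
  "bmult 6 1 = (1,5)" "bmult 1 6 = (-1,5)"
  "bmult 1 5 = (1,6)" "bmult 5 1 = (-1,6)"
  "bmult 6 7 = (1,2)" "bmult 7 6 = (-1,2)"
  "bmult 7 2 = (1,6)" "bmult 2 7 = (-1,6)"
  "bmult 2 6 = (1,7)" "bmult 6 2 = (-1,7)"
  "bmult 7 1 = (1,3)" "bmult 1 7 = (-1,3)"
  "bmult 1 3 = (1,7)" "bmult 3 1 = (-1,7)"
  "bmult 3 7 = (1,1)" "bmult 7 3 = (-1,1)"
  by (rule bmult_fano; simp add: fano_pos_iff)+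

lemma omult_e0: "omult (ebas 0) q = q"
proof -
  have "omult (ebas 0) q = omult (ebas 0) (\<Sum>k<8. ocomp q k *\<^sub>R ebas k)" by (simp add: ebas_expand)
  also have "\<dots> = (\<Sum>k<8. ocomp q k *\<^sub>R omult (ebas 0) (ebas k))"
    by (simp add: linear_sum[OF omult_linear] linear_scale[OF omult_linear])
  also have "\<dots> = (\<Sum>k<8. ocomp q k *\<^sub>R ebas k)"
    by (intro sum.cong refl) (simp add: omult_ebas bmult_unit)
  finally show ?thesis by (simp add: ebas_expand)
qed

text \<open>Left multiplication by an imaginary unit permutes the basis up to sign. The Clifford
  relations thus become identities between indices and signs, which a finite check of the table
  settles: equal indices in both orders, opposite signs for distinct units.\<close>

lemma bmult_clifford:
  assumes "l \<in> {1..<8}" "m \<in> {1..<8}" "k < 8"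
  shows "snd (bmult m k) < 8"
    and "snd (bmult m (snd (bmult m k))) = k"
    and "fst (bmult m (snd (bmult m k))) * fst (bmult m k) = -1"
    and "snd (bmult l (snd (bmult m k))) = snd (bmult m (snd (bmult l k)))"
    and "l \<noteq> m \<Longrightarrow> fst (bmult l (snd (bmult m k))) * fst (bmult m k)
           = - (fst (bmult m (snd (bmult l k))) * fst (bmult l k))"
proof -
  have all: "\<forall>m\<in>{1,2,3,4,5,6,7}. \<forall>k\<in>{0,1,2,3,4,5,6,7}.
    snd (bmult m k) < 8 \<and> snd (bmult m (snd (bmult m k))) = k \<and> fst (bmult m (snd (bmult m k))) * fst (bmult m k) = -1"
    \<comment> \<open>\<open>simplified\<close> turns the index 1 of the table into
      \<open>Suc 0\<close>, the form that the simplifier produces in the goal.\<close>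
    by (simp add: bmult_table[simplified] bmult_unit)
  have mk: "m \<in> {1,2,3,4,5,6,7}" "k \<in> {0,1,2,3,4,5,6,7}" using assms by auto
  show "snd (bmult m k) < 8" "snd (bmult m (snd (bmult m k))) = k"
     "fst (bmult m (snd (bmult m k))) * fst (bmult m k) = -1"
    using all[THEN bspec, OF mk(1), THEN bspec, OF mk(2)] by blast+
next
  have "\<forall>k\<in>{0,1,2,3,4,5,6,7}. snd (bmult l (snd (bmult m k))) = snd (bmult m (snd (bmult l k))) \<and> (l \<noteq> m \<longrightarrow>
    fst (bmult l (snd (bmult m k))) * fst (bmult m k)
           = - (fst (bmult m (snd (bmult l k))) * fst (bmult l k)))"
    if "l \<in> {1,2,3,4,5,6,7}" "m \<in> {1,2,3,4,5,6,7}"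
    using that by (elim insertE emptyE; hypsubst; simp only: ball_simps; simp add: bmult_table[simplified] bmult_unit)
  moreover have "l \<in> {1,2,3,4,5,6,7}" "m \<in> {1,2,3,4,5,6,7}" "k \<in> {0,1,2,3,4,5,6,7}" using assms by auto
  ultimately have "snd (bmult l (snd (bmult m k))) = snd (bmult m (snd (bmult l k))) \<and> (l \<noteq> m \<longrightarrow>
    fst (bmult l (snd (bmult m k))) * fst (bmult m k)
           = - (fst (bmult m (snd (bmult l k))) * fst (bmult l k)))" by meson
  then show "snd (bmult l (snd (bmult m k))) = snd (bmult m (snd (bmult l k)))"
    and "l \<noteq> m \<Longrightarrow> fst (bmult l (snd (bmult m k))) * fst (bmult m k)
           = - (fst (bmult m (snd (bmult l k))) * fst (bmult l k))"
    by simp_all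
qed

lemma omult_clifford_ebas:
  assumes "l \<in> {1..<8}" "m \<in> {1..<8}" "k < 8"
  shows "omult (ebas l) (omult (ebas m) (ebas k)) + omult (ebas m) (omult (ebas l) (ebas k))
         = (if l = m then -2 else 0) *\<^sub>R ebas k"
proof -
  have lt: "snd (bmult m k) < 8" "snd (bmult l k) < 8" "l < 8" "m < 8"
    using bmult_clifford(1)[OF assms] bmult_clifford(1)[OF assms(2,1,3)] assms by auto
  have e: "omult (ebas l) (omult (ebas m) (ebas k))
      = (fst (bmult l (snd (bmult m k))) * fst (bmult m k)) *\<^sub>R ebas (snd (bmult l (snd (bmult m k))))"
    "omult (ebas m) (omult (ebas l) (ebas k))
      = (fst (bmult m (snd (bmult l k))) * fst (bmult l k)) *\<^sub>R ebas (snd (bmult m (snd (bmult l k))))"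
    using lt assms by (simp_all add: omult_ebas linear_scale[OF omult_linear])
  show ?thesis
  proof (cases "l = m")
    case True
    then show ?thesis
      using bmult_clifford(2,3)[OF assms] unfolding e by (simp flip: scaleR_2)
  next
    case False
    then show ?thesis
      unfolding e bmult_clifford(4)[OF assms] bmult_clifford(5)[OF assms False] by simp
  qed
qed

text \<open>This takes the place of associativity: both sides are linear in \<open>q\<close>, so the
  basis case is enough.\<close>

lemma omult_clifford:
  assumes "l \<in> {1..<8}" "m \<in> {1..<8}"
  shows "omult (ebas l) (omult (ebas m) q) + omult (ebas m) (omult (ebas l) q)
         = (if l = m then -2 else 0) *\<^sub>R q"
proof -
  let ?A = "\<lambda>q. omult (ebas l) (omult (ebas m) q) + omult (ebas m) (omult (ebas l) q)"
  have lin: "linear ?A"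
    using linear_compose[OF omult_linear[of "ebas m"] omult_linear[of "ebas l"]]
      linear_compose[OF omult_linear[of "ebas l"] omult_linear[of "ebas m"]]
    by (intro linear_compose_add) (simp_all add: o_def)
  have "?A q = ?A (\<Sum>k<8. ocomp q k *\<^sub>R ebas k)" by (simp add: ebas_expand)
  also have "\<dots> = (\<Sum>k<8. ocomp q k *\<^sub>R ?A (ebas k))"
    by (simp only: linear_sum[OF lin] linear_scale[OF lin])
  also have "\<dots> = (\<Sum>k<8. (if l = m then -2 else 0) *\<^sub>R ocomp q k *\<^sub>R ebas k)"
    using omult_clifford_ebas[OF assms] by (intro sum.cong refl) auto
  also have "\<dots> = (if l = m then -2 else 0) *\<^sub>R q"
    by (simp only: ebas_expand flip: scaleR_sum_right)
  finally show ?thesis .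
qed

subsection \<open>A discrete Poisson equation on all of space\<close>

text \<open>The factor 1/k^2 is left out, so that the equations below involve no division by the
  step. The value type is general because the operator acts both on octonion-valued functions and on
  their components.\<close>

definition lap :: "real \<Rightarrow> (real^8 \<Rightarrow> 'a::real_vector) \<Rightarrow> real^8 \<Rightarrow> 'a" where
  "lap k u x = (\<Sum>l<8. u (x + k *\<^sub>R ebas l) + u (x - k *\<^sub>R ebas l) - 2 *\<^sub>R u x)"

lemma lap_axis: "lap k u x = (\<Sum>i\<in>UNIV. u (x + k *\<^sub>R axis i 1) + u (x - k *\<^sub>R axis i 1) - 2 *\<^sub>R u x)"
  unfolding lap_def ebas_def by (rule sum_of_nat_8)

lemma norm_ebas [simp]: "norm (ebas l) = 1"
  by (simp add: ebas_def norm_axis_1)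

lemma lap_diff: "lap k (\<lambda>x. u x - v x) x = lap k u x - lap k v x"
  unfolding lap_def sum_subtractf[symmetric] by (intro sum.cong refl) (simp add: algebra_simps)

lemma lap_mult: "lap k (\<lambda>x. c * u x) x = c * lap k u x" for u :: "real^8 \<Rightarrow> real"
  unfolding lap_def sum_distrib_left by (intro sum.cong refl) (simp add: algebra_simps)

lemma lap_norm_sq: "lap k (\<lambda>x. (norm x)\<^sup>2) x = 16 * k\<^sup>2"
proof -
  have "(norm (x + k *\<^sub>R ebas l))\<^sup>2 + (norm (x - k *\<^sub>R ebas l))\<^sup>2 - 2 *\<^sub>R (norm x)\<^sup>2 = 2 * k\<^sup>2" for l
    using norm_ebas[of l, unfolded norm_eq_1]
    unfolding power2_norm_eq_inner by (simp add: inner_add inner_diff power2_eq_square algebra_simps)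
  then show ?thesis by (simp add: lap_def)
qed

text \<open>Solving the equation for the value at the centre gives the averaging operator
  \<open>T\<close>, where 16 is the number of neighbours. Its iterates from 0 increase because
  \<open>p\<close> is nonnegative, and they stay below a quadratic barrier. Their pointwise limit is
  a fixed point, since each value of \<open>T\<close> involves only finitely many others.\<close>

lemma poisson_nonneg:
  fixes p :: "real^8 \<Rightarrow> real"
  assumes k: "0 < k" and R: "0 < R" and p: "\<And>x. 0 \<le> p x" "\<And>x. p x \<le> G"
  shows "\<exists>u. (\<forall>x. 0 \<le> u x \<and> u x \<le> G * (R + k)\<^sup>2 / 16) \<and>
    (\<forall>x. norm x < R \<longrightarrow> lap k u x = - k\<^sup>2 * p x)"
proof -
  define S where "S u x = (\<Sum>l<8. u (x + k *\<^sub>R ebas l) + u (x - k *\<^sub>R ebas l))"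
    for u :: "real^8 \<Rightarrow> real" and x
  define T where "T u x = (if norm x < R then (S u x + k\<^sup>2 * p x) / 16 else 0)" for u x
  define U where "U n = (T ^^ n) (\<lambda>_. 0)" for n
  \<comment> \<open>The factor G/16 gives \<open>lap k w = - k\<^sup>2 * G\<close>. The radius R + k
    instead of R keeps the barrier nonnegative at the neighbours of points of the ball.\<close>
  define w where "w x = G / 16 * ((R + k)\<^sup>2 - (norm x)\<^sup>2)" for x :: "real^8"
  have G: "0 \<le> G" using p[of 0] by linarith
  have US: "U (Suc n) = T (U n)" for n by (simp add: U_def)
  have S_mono: "S u x \<le> S v x"
    if "\<And>l. l < 8 \<Longrightarrow> u (x + k *\<^sub>R ebas l) \<le> v (x + k *\<^sub>R ebas l)"
       "\<And>l. l < 8 \<Longrightarrow> u (x - k *\<^sub>R ebas l) \<le> v (x - k *\<^sub>R ebas l)" for u v x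
    unfolding S_def using that by (intro sum_mono add_mono) auto
  have S_lap: "lap k u x = S u x - 16 * u x" for u x
    by (simp add: lap_def S_def sum_subtractf sum.distrib)
  have T_mono: "T u x \<le> T v x" if "\<And>x. u x \<le> v x" for u v x
    unfolding T_def using S_mono[of u x v, OF that that] by simp
  have Uinc: "U n x \<le> U (Suc n) x" for n x
  proof (induction n arbitrary: x)
    case 0
    then show ?case using p by (simp add: U_def T_def S_def)
  next
    case (Suc n)
    show ?case using T_mono[of "U n" "U (Suc n)" x, OF Suc.IH] by (simp only: US)
  qed
  have inc: "incseq (\<lambda>n. U n x)" for x
    using Uinc by (intro incseq_SucI) auto
  have Unn: "0 \<le> U n x" for n x
    using incseqD[OF inc, of 0 n x] by (simp add: U_def)
  have wS: "S w x = 16 * w x - k\<^sup>2 * G" for x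
  proof -
    have "lap k w x = - (G / 16) * lap k (\<lambda>x. (norm x)\<^sup>2) x"
      unfolding lap_def w_def sum_distrib_left by (intro sum.cong refl) (simp add: algebra_simps)
    then show ?thesis by (simp add: lap_norm_sq S_lap algebra_simps)
  qed
  have Uw: "norm x \<le> R + k \<Longrightarrow> U n x \<le> w x" for n x
  proof (induction n arbitrary: x)
    case 0
    then have "(norm x)\<^sup>2 \<le> (R + k)\<^sup>2" by (intro power_mono) auto
    with G show ?case by (simp add: U_def w_def)
  next
    case (Suc n)
    show ?case
    proof (cases "norm x < R")
      case True
      have nb: "norm (x + k *\<^sub>R ebas l) \<le> R + k" "norm (x - k *\<^sub>R ebas l) \<le> R + k" for l
        using norm_triangle_ineq[of x "k *\<^sub>R ebas l"] norm_triangle_ineq4[of x "k *\<^sub>R ebas l"] True k by auto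
      have "S (U n) x \<le> S w x" using nb by (intro S_mono Suc.IH) auto
      moreover have "k\<^sup>2 * p x \<le> k\<^sup>2 * G" using p by (intro mult_left_mono) auto
      ultimately show ?thesis using True wS[of x] by (simp add: US T_def)
    next
      case False
      have "(norm x)\<^sup>2 \<le> (R + k)\<^sup>2" using Suc.prems by (intro power_mono) auto
      with G False show ?thesis by (simp add: US T_def w_def)
    qed
  qed
  have UM: "U n x \<le> G * (R + k)\<^sup>2 / 16" for n x
  proof (cases "norm x \<le> R + k")
    case True
    have "w x \<le> G / 16 * (R + k)\<^sup>2" unfolding w_def using G by (intro mult_left_mono) auto
    with Uw[OF True, of n] show ?thesis by simp
  next
    case False
    then have "\<not> norm x < R" using k by simp
    then have "U n x = 0" by (cases n) (simp_all add: US T_def, simp add: U_def)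
    with G show ?thesis by simp
  qed
  define u where "u x = lim (\<lambda>n. U n x)" for x
  have lim: "(\<lambda>n. U n x) \<longlonglongrightarrow> u x" for x
  proof -
    obtain L where "(\<lambda>n. U n x) \<longlonglongrightarrow> L"
      by (rule incseq_convergent[OF inc, of x "G * (R + k)\<^sup>2 / 16"]) (use UM in blast)+
    then show ?thesis by (simp add: u_def limI)
  qed
  have "lap k u x = - k\<^sup>2 * p x" if "norm x < R" for x
  proof -
    have "(\<lambda>n. U (Suc n) x) \<longlonglongrightarrow> (S u x + k\<^sup>2 * p x) / 16"
      unfolding US T_def S_def using that by (simp only: if_True, intro tendsto_divide tendsto_add tendsto_sum tendsto_const lim) simp
    with LIMSEQ_Suc[OF lim[of x]] have "u x = (S u x + k\<^sup>2 * p x) / 16" by (rule LIMSEQ_unique)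
    then show ?thesis by (simp add: S_lap)
  qed
  moreover have "0 \<le> u x" "u x \<le> G * (R + k)\<^sup>2 / 16" for x
    by (rule LIMSEQ_le_const[OF lim], simp add: Unn) (rule LIMSEQ_le_const2[OF lim], use UM in blast)
  ultimately show ?thesis by blast
qed

text \<open>Positive and negative parts are treated separately. Both solutions take values in the
  same interval [0, C], so their difference satisfies the bound C without a factor 2.\<close>

lemma poisson:
  fixes g :: "real^8 \<Rightarrow> real"
  assumes k: "0 < k" and R: "0 < R" and g: "\<And>x. \<bar>g x\<bar> \<le> G"
  shows "\<exists>u. (\<forall>x. \<bar>u x\<bar> \<le> G * (R + k)\<^sup>2 / 16) \<and> (\<forall>x. norm x < R \<longrightarrow> lap k u x = k\<^sup>2 * g x)"
proof -
  have pos: "0 \<le> max (g x) 0" "max (g x) 0 \<le> G" and neg: "0 \<le> max (- g x) 0" "max (- g x) 0 \<le> G" for x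
    using g[of x] by auto
  define C where "C = G * (R + k)\<^sup>2 / 16"
  obtain u where u: "\<And>x. 0 \<le> u x \<and> u x \<le> C" "\<And>x. norm x < R \<Longrightarrow> lap k u x = - k\<^sup>2 * max (- g x) 0"
    using poisson_nonneg[of k R "\<lambda>x. max (- g x) 0" G, OF k R neg] unfolding C_def by auto
  obtain v where v: "\<And>x. 0 \<le> v x \<and> v x \<le> C" "\<And>x. norm x < R \<Longrightarrow> lap k v x = - k\<^sup>2 * max (g x) 0"
    using poisson_nonneg[of k R "\<lambda>x. max (g x) 0" G, OF k R pos] unfolding C_def by auto
  have "lap k (\<lambda>x. u x - v x) x = k\<^sup>2 * g x" if "norm x < R" for x
  proof -
    have "max (g x) 0 - max (- g x) 0 = g x" by (simp add: max_def)
    moreover have "lap k (\<lambda>x. u x - v x) x = k\<^sup>2 * (max (g x) 0 - max (- g x) 0)"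
      unfolding lap_diff u(2)[OF that] v(2)[OF that] by (simp add: right_diff_distrib)
    ultimately show ?thesis by simp
  qed
  moreover have "\<bar>u x - v x\<bar> \<le> C" for x
    using u(1)[of x] v(1)[of x] by linarith
  ultimately show ?thesis unfolding C_def by (intro exI[of _ "\<lambda>x. u x - v x"]) simp
qed

subsection \<open>Discrete gradient bound\<close>

lemma lap_nth_sq: "lap k (\<lambda>x. (x $ n)\<^sup>2) x = 2 * k\<^sup>2"
proof -
  have "lap k (\<lambda>x. (x $ n)\<^sup>2) x = (\<Sum>i\<in>UNIV. if i = n then 2 * k\<^sup>2 else 0)"
    unfolding lap_axis by (intro sum.cong refl) (simp add: axis_def power2_eq_square algebra_simps)
  then show ?thesis by simp
qed

lemma lap_nth: "lap k (\<lambda>x. x $ n) x = 0"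
  unfolding lap_axis by (rule sum.neutral) simp

lemma lap_const: "lap k (\<lambda>x. c) x = 0" for c :: real
  unfolding lap_def by simp

lemma lap_add: "lap k (\<lambda>x. u x + v x) x = lap k u x + lap k v x"
  unfolding lap_def sum.distrib[symmetric] by (intro sum.cong refl) (simp add: algebra_simps)

definition reflect :: "8 \<Rightarrow> real^8 \<Rightarrow> real^8" where
  "reflect n y = y - (2 * y $ n) *\<^sub>R axis n 1"

lemma reflect_nth: "reflect n y $ i = (if i = n then - y $ n else y $ i)"
  by (simp add: reflect_def axis_def)

lemma reflect_add_axis:
  "reflect n (y + k *\<^sub>R axis i 1) = (if i = n then reflect n y - k *\<^sub>R axis i 1 else reflect n y + k *\<^sub>R axis i 1)"
  by (auto simp: vec_eq_iff reflect_nth axis_def)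

lemma norm_sq_nth: "(norm y)\<^sup>2 = (\<Sum>i\<in>UNIV. (y $ i)\<^sup>2)" for y :: "real^8"
  unfolding power2_norm_eq_inner inner_vec_def by (simp add: power2_eq_square)

lemma norm_reflect: "(norm (reflect n y))\<^sup>2 = (norm y)\<^sup>2"
  unfolding norm_sq_nth by (intro sum.cong refl) (simp add: reflect_nth)

lemma lap_reflect: "lap k (\<lambda>y. u (reflect n y)) y = lap k u (reflect n y)"
  unfolding lap_axis
  using reflect_add_axis[of n y k] reflect_add_axis[of n y "-k"]
  by (intro sum.cong refl) auto

lemma norm_sq_ge: "i \<noteq> n \<Longrightarrow> (y $ i)\<^sup>2 + (y $ n)\<^sup>2 \<le> (norm y)\<^sup>2" for y :: "real^8"
  unfolding norm_sq_nth
  using sum_mono2[of UNIV "{i, n}" "\<lambda>i. (y $ i)\<^sup>2"] by simp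

lemma norm_sq_ge1: "(y $ n)\<^sup>2 \<le> (norm y)\<^sup>2" for y :: "real^8"
  unfolding norm_sq_nth by (rule member_le_sum) auto

lemma gradient_bound_0:
  fixes u :: "real^8 \<Rightarrow> real"
  assumes h: "0 < h" "h \<le> 1/4"
    and M: "\<And>y. \<bar>u y\<bar> \<le> M"
    and G: "\<And>y. norm y < 3 \<Longrightarrow> \<bar>lap (2*h) u y\<bar> \<le> (2*h)\<^sup>2 * G"
    and K: "G < K" "2 * M \<le> K"
  shows "u (h *\<^sub>R axis n 1) - u (- (h *\<^sub>R axis n 1)) \<le> 20 * K * h"
proof -
  define k where "k = 2 * h"
  define \<phi> where "\<phi> y = u y - u (reflect n y)" for y
  txt \<open>As in the continuous gradient estimate, the odd part of \<open>u\<close> is compared with a quadratic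
    barrier. The term \<open>8 * h\<^sup>2\<close> compensates that the neighbours of the first layer \<open>y $ n = h\<close> lie
    on the mirror layer \<open>y $ n = - h\<close> and not on the mirror itself.\<close>
  define \<psi> where "\<psi> y = K * ((norm y)\<^sup>2 - 9 * (y $ n)\<^sup>2 + 20 * y $ n + 8 * h\<^sup>2)" for y :: "real^8"
  define v where "v y = \<psi> y - \<phi> y" for y
  \<comment> \<open>Only the n-th coordinate is discretised. It runs through odd multiples of
    \<open>h\<close> in steps of \<open>k = 2 * h\<close>, so that the layer below \<open>h\<close>
    is the mirror image of the layer \<open>h\<close> itself.\<close>
  define Q where "Q = {y. (\<forall>i. i \<noteq> n \<longrightarrow> \<bar>y $ i\<bar> < 1) \<and> 0 < y $ n \<and> y $ n < 1 \<and> (\<exists>j::int. y $ n = (2 * of_int j + 1) * h)}"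
  have M0: "0 \<le> M" using M[of 0] by linarith
  have K0: "0 \<le> K" using M0 K by linarith
  have \<phi>_le: "\<phi> y \<le> K" "- K \<le> \<phi> y" for y
    using M[of y] M[of "reflect n y"] K unfolding \<phi>_def by linarith+
  \<comment> \<open>The quadratic terms contribute 16 k^2 - 18 k^2. The coefficient 9 is the least
    integer that makes the barrier strictly superharmonic, and the margin 2 K k^2 beats the 2 G k^2
    that the odd part can contribute.\<close>
  have lap_psi: "lap k \<psi> y = - 2 * K * k\<^sup>2" for y
    unfolding \<psi>_def lap_mult lap_add lap_diff lap_norm_sq lap_nth_sq lap_nth lap_const by simp
  have lap_v: "lap k v y \<le> - 2 * (K - G) * k\<^sup>2" if "norm y < 3" for y
  proof -
    have "norm (reflect n y) < 3" using that norm_reflect[of n y] by (simp add: power2_eq_iff_nonneg)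
    then have "\<bar>lap k \<phi> y\<bar> \<le> 2 * (k\<^sup>2 * G)"
      using G[OF that] G[of "reflect n y"] unfolding \<phi>_def lap_diff lap_reflect k_def by linarith
    then show ?thesis unfolding v_def lap_diff lap_psi by (simp add: algebra_simps abs_le_iff)
  qed
  have v_nonneg: "0 \<le> v y" if "1 \<le> (norm y)\<^sup>2 - 9 * (y $ n)\<^sup>2 + 20 * y $ n" for y
  proof -
    have "K * 1 \<le> \<psi> y" unfolding \<psi>_def using that K0 zero_le_power2[of h] by (intro mult_left_mono) linarith+
    with \<phi>_le[of y] show ?thesis by (simp add: v_def)
  qed
  \<comment> \<open>Eight coordinates of modulus below 1 give a squared norm of at most 8 < 9; this
    is the origin of the radius 3 in the assumption on the Laplacian.\<close>
  have norm_Q: "norm y < 3" if "y \<in> Q" for y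
  proof -
    have "\<bar>y $ i\<bar> < 1" for i using that unfolding Q_def by (cases "i = n") auto
    then have "(norm y)\<^sup>2 \<le> (\<Sum>i\<in>(UNIV::8 set). 1)" unfolding norm_sq_nth
      by (intro sum_mono) (simp add: abs_square_le_1 less_imp_le)
    then have "(norm y)\<^sup>2 < 3\<^sup>2" by simp
    then show ?thesis by (rule power2_less_imp_less) simp
  qed
  have "0 \<le> v y" if "y \<in> Q" for y
  proof (rule ccontr)
    assume neg: "\<not> 0 \<le> v y"
    define m where "m = Inf (v ` Q)"
    have bdd: "bdd_below (v ` Q)"
    proof (rule bdd_belowI2)
      fix z assume z: "z \<in> Q"
      have "K * (- 9) \<le> \<psi> z"
      proof -
        have zn: "0 < z $ n" "z $ n < 1" using z by (auto simp: Q_def)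
        then have "(z $ n)\<^sup>2 \<le> 1" by (simp add: abs_square_le_1)
        then show ?thesis unfolding \<psi>_def
          using zn K0 zero_le_power2[of h] zero_le_power2[of "norm z"]
          by (intro mult_left_mono) linarith+
      qed
      then show "- 10 * K \<le> v z" using \<phi>_le[of z] by (simp add: v_def)
    qed
    have mle: "m \<le> v z" if "z \<in> Q" for z
      unfolding m_def using that bdd by (intro cInf_lower) auto
    have mneg: "m < 0" using mle[OF that] neg by simp
    \<comment> \<open>The infimum over the infinite set \<open>Q\<close> need not be attained, so a
      point within \<epsilon> of it is used. All its neighbours have values at least
      \<open>m\<close>, hence each of the 8 second differences exceeds -2 \<epsilon>. Their sum
      exceeds -16 \<epsilon>, which is exactly the upper bound in \<open>lap_v\<close>.\<close>
    define \<epsilon> where "\<epsilon> = (K - G) * k\<^sup>2 / 8"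
    have eps: "0 < \<epsilon>" using K h by (simp add: \<epsilon>_def k_def)
    have "\<exists>z\<in>v ` Q. z < min (m + \<epsilon>) 0"
      using that eps mneg unfolding m_def by (intro cInf_lessD) auto
    then obtain z where z: "z \<in> Q" "v z < m + \<epsilon>" "v z < 0" by auto
    have zn: "0 < z $ n" "z $ n < 1" "\<And>i. i \<noteq> n \<Longrightarrow> \<bar>z $ i\<bar> < 1" using z by (auto simp: Q_def)
    obtain j :: int where j: "z $ n = (2 * of_int j + 1) * h" using z by (auto simp: Q_def)
    have side: "m \<le> v (z + s *\<^sub>R axis i 1)" if i: "i \<noteq> n" for i s
    proof (cases "\<bar>z $ i + s\<bar> < 1")
      case True
      then show ?thesis using z i by (intro mle) (auto simp: Q_def axis_def)
    next
      case False
      let ?y = "z + s *\<^sub>R axis i 1"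
      have y: "?y $ i = z $ i + s" "?y $ n = z $ n" using i by (simp_all add: axis_def)
      \<comment> \<open>Beyond a lateral face the i-th coordinate alone contributes 1, and the rest,
        -8 t^2 + 20 t with t = \<open>z $ n\<close> in (0,1), is positive.\<close>
      have "1 \<le> (z $ i + s)\<^sup>2" using False by (simp add: abs_square_less_1 flip: not_less)
      moreover have "(z $ n)\<^sup>2 \<le> z $ n" using zn by (simp add: power2_eq_square mult_left_le)
      ultimately have "0 \<le> v ?y"
        using norm_sq_ge[OF i, of ?y] zn(1) unfolding y by (intro v_nonneg) (unfold y, linarith)
      with mneg show ?thesis by simp
    qed
    have up: "m \<le> v (z + k *\<^sub>R axis n 1)"
    proof (cases "z $ n + k < 1")
      case True
      have "z $ n + k = (2 * of_int (j + 1) + 1) * h" by (simp add: j k_def algebra_simps)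
      then have "\<exists>j::int. z $ n + k = (2 * of_int j + 1) * h" by blast
      then show ?thesis using z True h by (intro mle) (auto simp: Q_def axis_def k_def)
    next
      case False
      let ?y = "z + k *\<^sub>R axis n 1"
      define t where "t = z $ n + k"
      have yn: "?y $ n = t" by (simp add: t_def)
      have t: "1 \<le> t" "t \<le> 3/2" using False zn h by (auto simp: t_def k_def)
      \<comment> \<open>A step of length at most 1/2 leaves the box at a height t between 1 and 3/2.
        Multiplying this product by 8 gives -8 t^2 + 20 t >= 12, with the coefficient 20 = 8 * 5/2
        of the barrier.\<close>
      have "0 \<le> (t - 1) * (3/2 - t)" using t by (intro mult_nonneg_nonneg) auto
      moreover have "(t - 1) * (3/2 - t) = 5/2 * t - t\<^sup>2 - 3/2" by (simp add: power2_eq_square field_simps)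
      ultimately have "1 \<le> - 8 * t\<^sup>2 + 20 * t" by linarith
      then have "0 \<le> v ?y" using norm_sq_ge1[of ?y n] unfolding yn by (intro v_nonneg) (unfold yn, linarith)
      with mneg show ?thesis by simp
    qed
    have down: "m \<le> v (z - k *\<^sub>R axis n 1)"
    proof (cases "0 < z $ n - k")
      case True
      have "z $ n - k = (2 * of_int (j - 1) + 1) * h" by (simp add: j k_def algebra_simps)
      then have "\<exists>j::int. z $ n - k = (2 * of_int j + 1) * h" by blast
      then show ?thesis using z True h by (intro mle) (auto simp: Q_def axis_def k_def)
    next
      case False
      have "0 < (2 * of_int j + 1 :: real)" "(2 * of_int j - 1 :: real) \<le> 0"
        using zn(1) False h unfolding j k_def
        by (simp_all add: zero_less_mult_iff)
      then have "j = 0" by linarith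
      then have zh: "z $ n = h" using j by simp
      \<comment> \<open>Since the odd part changes sign under the reflection, it cancels from the
        sum of the values of \<open>v\<close> at \<open>z\<close> and at its mirror image. That sum
        is nonnegative, so a negative value at \<open>z\<close> forces a positive one at the
        neighbour.\<close>
      have refl: "z - k *\<^sub>R axis n 1 = reflect n z" by (simp add: reflect_def zh k_def)
      have "reflect n (reflect n z) = z" by (simp add: vec_eq_iff reflect_nth)
      then have "v (reflect n z) = \<psi> (reflect n z) + \<phi> z" by (simp add: v_def \<phi>_def)
      moreover have "\<psi> (reflect n z) + \<psi> z = 2 * K * ((norm z)\<^sup>2 - h\<^sup>2)"
        by (simp add: \<psi>_def norm_reflect reflect_nth zh algebra_simps)
      moreover have "0 \<le> 2 * K * ((norm z)\<^sup>2 - h\<^sup>2)"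
        using K0 norm_sq_ge1[of z n] by (simp add: zh)
      ultimately have "0 \<le> v (reflect n z)" using z(3) by (simp add: v_def)
      with mneg show ?thesis by (simp add: refl)
    qed
    have "(\<Sum>i\<in>(UNIV::8 set). - 2 * \<epsilon>) < lap k v z"
      unfolding lap_axis
    proof (rule sum_strict_mono)
      fix i :: 8
      have "m \<le> v (z + k *\<^sub>R axis i 1)" "m \<le> v (z - k *\<^sub>R axis i 1)"
        using side[of i k] side[of i "- k"] up down by (cases "i = n"; simp)+
      then show "- 2 * \<epsilon> < v (z + k *\<^sub>R axis i 1) + v (z - k *\<^sub>R axis i 1) - 2 *\<^sub>R v z"
        using z(2) by simp
    qed auto
    with lap_v[OF norm_Q[OF z(1)]] show False by (simp add: \<epsilon>_def algebra_simps)
  qed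
  moreover have "h *\<^sub>R axis n 1 \<in> Q"
    using h by (auto simp: Q_def axis_def intro: exI[of _ 0])
  ultimately have "0 \<le> v (h *\<^sub>R axis n 1)" by blast
  \<comment> \<open>The terms in h^2 cancel, 1 - 9 + 8 = 0, so the barrier is exactly linear in
    \<open>h\<close> at the point of interest.\<close>
  moreover have "\<psi> (h *\<^sub>R axis n 1) = 20 * K * h"
    by (simp add: \<psi>_def norm_axis_1 power_mult_distrib)
  moreover have "reflect n (h *\<^sub>R axis n 1) = - (h *\<^sub>R axis n 1)"
    by (simp add: vec_eq_iff reflect_nth axis_def)
  ultimately show ?thesis by (simp add: v_def \<phi>_def)
qed

text \<open>The estimate at the origin is translated to \<open>x\<close> and applied to
  \<open>u\<close> and to \<open>- u\<close>.\<close>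

lemma gradient_bound:
  fixes u :: "real^8 \<Rightarrow> real"
  assumes h: "0 < h" "h \<le> 1/4"
    and M: "\<And>y. \<bar>u y\<bar> \<le> M"
    and G: "\<And>y. norm (y - x) < 3 \<Longrightarrow> \<bar>lap (2*h) u y\<bar> \<le> (2*h)\<^sup>2 * G"
    and K: "G < K" "2 * M \<le> K"
  shows "\<bar>u (x + h *\<^sub>R ebas l) - u (x - h *\<^sub>R ebas l)\<bar> \<le> 20 * K * h"
proof -
  have lap_u: "lap (2*h) (\<lambda>y. u (x + y)) y = lap (2*h) u (x + y)" for y
    by (simp add: lap_def algebra_simps)
  have lap_mu: "lap (2*h) (\<lambda>y. - u (x + y)) y = - lap (2*h) u (x + y)" for y
    using lap_diff[of "2*h" "\<lambda>_. 0" "\<lambda>y. u (x + y)" y] lap_const[of "2*h" 0] by (simp add: lap_u)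
  have "u (x + h *\<^sub>R ebas l) - u (x - h *\<^sub>R ebas l) \<le> 20 * K * h"
    using gradient_bound_0[OF h, of "\<lambda>y. u (x + y)" M G K "of_nat l"] M G K
    by (simp add: ebas_def lap_u)
  moreover have "- u (x + h *\<^sub>R ebas l) + u (x - h *\<^sub>R ebas l) \<le> 20 * K * h"
    using gradient_bound_0[OF h, of "\<lambda>y. - u (x + y)" M G K "of_nat l"] M G K
    by (simp add: ebas_def lap_mu)
  ultimately show ?thesis by (simp add: abs_le_iff)
qed

subsection \<open>A bounded right inverse of the discrete operator\<close>

definition oconj_mult :: "nat \<Rightarrow> real^8 \<Rightarrow> real^8" where
  "oconj_mult m q = (if m = 0 then q else - omult (ebas m) q)"

lemma linear_oconj_mult: "linear (oconj_mult m)"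
proof -
  have "oconj_mult m = (if m = 0 then (\<lambda>q. q) else (\<lambda>q. - omult (ebas m) q))"
    by (auto simp: oconj_mult_def)
  then show ?thesis
    by (simp add: linear_compose_neg omult_linear module_hom_ident linear_id[unfolded id_def])
qed

text \<open>If exactly one index is 0, the two terms cancel because conjugation changes the sign of
  imaginary units only. For two imaginary units this is the Clifford relation with its sign
  reversed.\<close>

lemma omult_oconj:
  assumes "l < 8" "m < 8"
  shows "omult (ebas l) (oconj_mult m q) + omult (ebas m) (oconj_mult l q) = (if l = m then 2 *\<^sub>R q else 0)"
proof (cases "l = 0 \<or> m = 0")
  case True
  then show ?thesis
    by (auto simp: oconj_mult_def omult_e0 linear_neg[OF omult_linear] scaleR_2)
next
  case False
  then have "omult (ebas l) (omult (ebas m) q) + omult (ebas m) (omult (ebas l) q) = (if l = m then -2 else 0) *\<^sub>R q"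
    using assms by (intro omult_clifford) auto
  then have "- (omult (ebas l) (omult (ebas m) q) + omult (ebas m) (omult (ebas l) q)) = (if l = m then 2 *\<^sub>R q else 0)"
    by simp
  then show ?thesis using False by (simp add: oconj_mult_def linear_neg[OF omult_linear])
qed

text \<open>Adding the double sum to its transpose pairs the terms (l,m) and (m,l); the symmetry of
  \<open>q\<close> then lets the off-diagonal ones cancel.\<close>

lemma sum_omult_oconj:
  assumes "\<And>l m. l < 8 \<Longrightarrow> m < 8 \<Longrightarrow> q l m = q m l"
  shows "(\<Sum>l<8. \<Sum>m<8. omult (ebas l) (oconj_mult m (q l m))) = (\<Sum>l<8. q l l)" (is "?S = _")
proof -
  have "?S + ?S = (\<Sum>l<8. \<Sum>m<8. omult (ebas l) (oconj_mult m (q l m))) + (\<Sum>l<8. \<Sum>m<8. omult (ebas m) (oconj_mult l (q m l)))"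
    by (subst (3) sum.swap) simp
  also have "\<dots> = (\<Sum>l<8. \<Sum>m<8. omult (ebas l) (oconj_mult m (q l m)) + omult (ebas m) (oconj_mult l (q l m)))"
    unfolding sum.distrib
    by (intro arg_cong2[where f = "(+)"] sum.cong refl) (metis assms lessThan_iff)
  also have "\<dots> = (\<Sum>l<8. \<Sum>m<8. if l = m then 2 *\<^sub>R q l m else 0)"
    by (intro sum.cong refl omult_oconj) auto
  also have "\<dots> = 2 *\<^sub>R (\<Sum>l<8. q l l)"
    by (simp add: scaleR_sum_right)
  finally have "2 *\<^sub>R ?S = 2 *\<^sub>R (\<Sum>l<8. q l l)" by (simp add: scaleR_2)
  then show ?thesis by simp
qed

definition Dh_conj :: "real \<Rightarrow> (real^8 \<Rightarrow> real^8) \<Rightarrow> real^8 \<Rightarrow> real^8" where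
  "Dh_conj h u x = (\<Sum>m<8. oconj_mult m ((1 / (2 * h)) *\<^sub>R (u (x + h *\<^sub>R ebas m) - u (x - h *\<^sub>R ebas m))))"

text \<open>Shifts commute, so the mixed central differences are symmetric and only the diagonal
  survives. A central difference of step h taken twice is a second difference of step 2h.\<close>

lemma Dh_Dh_conj:
  assumes "h \<noteq> 0"
  shows "Dh h (Dh_conj h u) x = (1 / (2 * h)\<^sup>2) *\<^sub>R lap (2 * h) u x"
proof -
  define q where "q l m = (1 / (2 * h)\<^sup>2) *\<^sub>R
     (u (x + h *\<^sub>R ebas l + h *\<^sub>R ebas m) - u (x + h *\<^sub>R ebas l - h *\<^sub>R ebas m)
      - (u (x - h *\<^sub>R ebas l + h *\<^sub>R ebas m) - u (x - h *\<^sub>R ebas l - h *\<^sub>R ebas m)))" for l m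
  have "(1 / (2 * h)) *\<^sub>R (Dh_conj h u (x + h *\<^sub>R ebas l) - Dh_conj h u (x - h *\<^sub>R ebas l))
      = (\<Sum>m<8. oconj_mult m (q l m))" for l
    unfolding Dh_conj_def q_def sum_subtractf[symmetric] scaleR_sum_right
      linear_diff[OF linear_oconj_mult, symmetric] linear_scale[OF linear_oconj_mult, symmetric]
    by (intro sum.cong refl arg_cong[where f = "oconj_mult _"])
      (simp add: power2_eq_square flip: scaleR_diff_right)
  then have "Dh h (Dh_conj h u) x = (\<Sum>l<8. \<Sum>m<8. omult (ebas l) (oconj_mult m (q l m)))"
    by (simp add: Dh_def linear_sum[OF omult_linear])
  also have "\<dots> = (\<Sum>l<8. q l l)"
    by (rule sum_omult_oconj) (simp add: q_def algebra_simps)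
  also have "\<dots> = (1 / (2 * h)\<^sup>2) *\<^sub>R lap (2 * h) u x"
    unfolding lap_def scaleR_sum_right
  proof (intro sum.cong refl)
    fix l :: nat
    have e: "h *\<^sub>R ebas l + h *\<^sub>R ebas l = (2 * h) *\<^sub>R ebas l" by (simp only: mult_2 scaleR_left.add)
    have p: "x + h *\<^sub>R ebas l + h *\<^sub>R ebas l = x + (2 * h) *\<^sub>R ebas l"
      "x - h *\<^sub>R ebas l - h *\<^sub>R ebas l = x - (2 * h) *\<^sub>R ebas l"
      by (simp_all only: e add.assoc diff_diff_eq)
    show "q l l = (1 / (2 * h)\<^sup>2) *\<^sub>R (u (x + (2 * h) *\<^sub>R ebas l) + u (x - (2 * h) *\<^sub>R ebas l) - 2 *\<^sub>R u x)"
      unfolding q_def p by (simp add: scaleR_2)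
  qed
  finally show ?thesis .
qed

lemma omult_ebas_bound: "\<exists>c>0. \<forall>l<8. \<forall>q. norm (omult (ebas l) q) \<le> c * norm q"
proof -
  have "\<exists>c>0. \<forall>q. norm (omult (ebas l) q) \<le> c * norm q" for l
    using linear_bounded_pos[OF omult_linear] by blast
  then obtain c where c: "\<And>l. c l > 0" "\<And>l q. norm (omult (ebas l) q) \<le> c l * norm q" by metis
  have "norm (omult (ebas l) q) \<le> (\<Sum>l<8. c l) * norm q" if "l < 8" for l q
  proof -
    have "c l \<le> (\<Sum>l<8. c l)" using that c(1) by (intro member_le_sum) (auto intro: less_imp_le)
    then show ?thesis using c(2)[of l q] by (meson mult_right_mono norm_ge_zero order_trans)
  qed
  moreover have "(\<Sum>l<8. c l) > 0" using c(1) by (intro sum_pos2[of _ 0]) (auto intro: less_imp_le)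
  ultimately show ?thesis by blast
qed

lemma lap_vec_nth: "lap k u x $ i = lap k (\<lambda>x. u x $ i) x"
  by (simp add: lap_def)

text \<open>With \<open>u\<close> a componentwise solution of the Poisson equation with right-hand
  side \<open>g\<close>, the function \<open>Dh_conj h u\<close> is a preimage of \<open>g\<close>.
  It consists of first differences of \<open>u\<close> divided by 2h, so the gradient bound, being
  linear in \<open>h\<close>, leaves a constant that depends on \<open>r\<close> alone.\<close>

lemma Dh_right_inverse:
  assumes "0 < r"
  shows "\<exists>C>0. \<forall>h g G. 0 < h \<longrightarrow> h \<le> 1/4 \<longrightarrow> 0 < G \<longrightarrow> (\<forall>x. norm (g x) \<le> G) \<longrightarrow>
    (\<exists>w. \<forall>x. norm x < r \<longrightarrow> Dh h w x = g x \<and> norm (w x) \<le> C * G)"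
proof -
  obtain c where c: "c > 0" "\<And>l q. l < 8 \<Longrightarrow> norm (omult (ebas l) q) \<le> (c::real) * norm q"
    using omult_ebas_bound by blast
  \<comment> \<open>The gradient bound at a point needs the Laplacian within distance 3 of
    it.\<close>
  define R where "R = r + 3"
  \<comment> \<open>\<open>A * G\<close> serves as the constant \<open>K\<close> of the gradient
    bound: the summand 2 makes it exceed \<open>G\<close>, the other summand times \<open>G\<close>
    is \<open>2 * M\<close>.\<close>
  define A where "A = 2 + (R + 1)\<^sup>2 / 8"
  \<comment> \<open>Each component difference is at most 20 A G h, so the vector is at most 160 A G
    h; division by 2h leaves 80, and there are 8 directions.\<close>
  define C where "C = 640 * (1 + c) * A"
  have A: "A \<ge> 2" by (simp add: A_def)
  have "\<exists>w. \<forall>x. norm x < r \<longrightarrow> Dh h w x = g x \<and> norm (w x) \<le> C * G"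
    if h: "0 < h" "h \<le> 1/4" and G: "0 < G" and g: "\<And>x. norm (g x) \<le> G" for h G and g :: "real^8 \<Rightarrow> real^8"
  proof -
    define M where "M = G * (R + 1)\<^sup>2 / 16"
    have MM: "G * (R + 2 * h)\<^sup>2 / 16 \<le> M"
      unfolding M_def using h G assms by (intro divide_right_mono mult_left_mono power_mono) (auto simp: R_def)
    have "\<exists>u. (\<forall>x. \<bar>u x\<bar> \<le> M) \<and> (\<forall>x. norm x < R \<longrightarrow> lap (2*h) u x = (2*h)\<^sup>2 * (g x $ i))" for i
    proof -
      have "\<bar>g x $ i\<bar> \<le> G" for x using g[of x] component_le_norm_cart[of "g x" i] by linarith
      then show ?thesis using poisson[of "2*h" R "\<lambda>x. g x $ i" G] MM h assms unfolding R_def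
        by (metis (no_types, lifting) order_trans add_pos_pos mult_pos_pos zero_less_numeral)
    qed
    then obtain U where U: "\<And>i x. \<bar>U i x\<bar> \<le> M" "\<And>i x. norm x < R \<Longrightarrow> lap (2*h) (U i) x = (2*h)\<^sup>2 * (g x $ i)"
      by metis
    define u where "u x = (\<chi> i. U i x)" for x
    have lap_u: "lap (2*h) u x = (2*h)\<^sup>2 *\<^sub>R g x" if "norm x < R" for x
      using U(2)[OF that] by (simp add: vec_eq_iff lap_vec_nth u_def)
    have "2 * G \<le> A * G" using A G by (intro mult_right_mono) auto
    with G have K: "G < A * G" "2 * M \<le> A * G" by (linarith, simp add: M_def A_def algebra_simps)
    have du: "norm (u (x + h *\<^sub>R ebas l) - u (x - h *\<^sub>R ebas l)) \<le> 160 * (A * G) * h" if "norm x < r" for x l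
    proof -
      have "\<bar>lap (2*h) (U i) y\<bar> \<le> (2*h)\<^sup>2 * G" if "norm (y - x) < 3" for i y
      proof -
        have "norm y < R" using norm_triangle_ineq2[of y x] that \<open>norm x < r\<close> by (simp add: R_def)
        then show ?thesis
          using g[of y] component_le_norm_cart[of "g y" i] by (simp add: U(2) abs_mult mult_left_mono)
      qed
      then have "\<bar>(u (x + h *\<^sub>R ebas l) - u (x - h *\<^sub>R ebas l)) $ i\<bar> \<le> 20 * (A * G) * h" for i
        using gradient_bound[where u = "U i" and x = x and l = l, OF h U(1) _ K] by (simp add: u_def)
      then have "(\<Sum>i\<in>UNIV. \<bar>(u (x + h *\<^sub>R ebas l) - u (x - h *\<^sub>R ebas l)) $ i\<bar>) \<le> (\<Sum>i\<in>(UNIV::8 set). 20 * (A * G) * h)"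
        by (intro sum_mono) auto
      then show ?thesis using norm_le_l1_cart[of "u (x + h *\<^sub>R ebas l) - u (x - h *\<^sub>R ebas l)"] by simp
    qed
    have "norm (Dh_conj h u x) \<le> C * G" if "norm x < r" for x
    proof -
      have o: "norm (oconj_mult m q) \<le> (1 + c) * norm q" if "m < 8" for m q
        using c(2)[OF that, of q] c(1) by (auto simp: oconj_mult_def distrib_right intro: add_increasing)
      have "norm (Dh_conj h u x) \<le> (\<Sum>m<(8::nat). (1 + c) * (1 / (2*h) * (160 * (A * G) * h)))"
        unfolding Dh_conj_def
      proof (rule sum_norm_le)
        fix m :: nat assume "m \<in> {..<8}"
        then have "norm (oconj_mult m ((1 / (2 * h)) *\<^sub>R (u (x + h *\<^sub>R ebas m) - u (x - h *\<^sub>R ebas m))))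
          \<le> (1 + c) * norm ((1 / (2 * h)) *\<^sub>R (u (x + h *\<^sub>R ebas m) - u (x - h *\<^sub>R ebas m)))"
          by (intro o) auto
        also have "\<dots> \<le> (1 + c) * (1 / (2*h) * (160 * (A * G) * h))"
          unfolding norm_scaleR using du[OF that] h c by (intro mult_mono) auto
        finally show "norm (oconj_mult m ((1 / (2 * h)) *\<^sub>R (u (x + h *\<^sub>R ebas m) - u (x - h *\<^sub>R ebas m))))
          \<le> (1 + c) * (1 / (2*h) * (160 * (A * G) * h))" .
      qed
      also have "\<dots> = C * G" using h by (simp add: C_def)
      finally show ?thesis .
    qed
    moreover have "Dh h (Dh_conj h u) x = g x" if "norm x < r" for x
      using lap_u[of x] that h by (simp add: Dh_Dh_conj R_def)
    ultimately show ?thesis by blast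
  qed
  moreover have "C > 0" using A c by (simp add: C_def)
  ultimately show ?thesis by blast
qed

subsection \<open>Functions with continuous partial derivatives\<close>

text \<open>One level of \<open>Ck\<close> on an open set, with the partial derivatives as an
  explicit argument instead of an existential, so that the same functions can be estimated and
  composed later.\<close>

definition has_partials :: "(real^8) set \<Rightarrow> (real^8 \<Rightarrow> 'b::real_normed_vector) \<Rightarrow> (nat \<Rightarrow> real^8 \<Rightarrow> 'b) \<Rightarrow> bool" where
  "has_partials U f g \<longleftrightarrow>
     (\<forall>l<8. continuous_on U (g l) \<and> (\<forall>x\<in>U. ((\<lambda>t. f (x + t *\<^sub>R ebas l)) has_vector_derivative g l x) (at 0)))"

lemma Ck_continuous: "Ck k U S f \<Longrightarrow> continuous_on S f"
  by (cases k) auto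

lemma Ck_has_partials:
  assumes "Ck (Suc k) U S f" "U \<subseteq> S"
  shows "\<exists>g. has_partials U f g \<and> (\<forall>l<8. continuous_on S (g l))"
proof -
  have "\<forall>l. \<exists>g. l < 8 \<longrightarrow> (\<forall>x\<in>U. ((\<lambda>t. f (x + t *\<^sub>R ebas l)) has_vector_derivative g x) (at 0)) \<and> Ck k U S g"
    using assms(1) by auto
  then obtain g where "\<forall>l. l < 8 \<longrightarrow> (\<forall>x\<in>U. ((\<lambda>t. f (x + t *\<^sub>R ebas l)) has_vector_derivative g l x) (at 0)) \<and> Ck k U S (g l)"
    by (rule choice[THEN exE])
  then show ?thesis
    using Ck_continuous continuous_on_subset[OF _ assms(2)] unfolding has_partials_def
    by (intro exI[of _ g]) blast
qed

lemma partial_shift: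
  fixes f :: "real^8 \<Rightarrow> 'b::real_normed_vector"
  assumes "((\<lambda>t. f (z + s *\<^sub>R e + t *\<^sub>R e)) has_vector_derivative d) (at 0)"
  shows "((\<lambda>t. f (z + t *\<^sub>R e)) has_vector_derivative d) (at s)"
proof -
  have "((\<lambda>t. t - s) has_vector_derivative 1) (at s)"
    by (auto intro!: derivative_eq_intros)
  from vector_diff_chain_at[OF this, of "\<lambda>t. f (z + s *\<^sub>R e + t *\<^sub>R e)" d] assms
  show ?thesis by (simp add: o_def algebra_simps)
qed

text \<open>Mean value inequality for f(z + te) - tc. It is used for total differentiability, for
  comparing D^h with D, and for finding inward directions; the closed segment admits negative
  increments.\<close>

lemma partial_increment_bound:
  fixes f :: "real^8 \<Rightarrow> 'b::real_normed_vector"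
  assumes "\<And>t. t \<in> closed_segment 0 s \<Longrightarrow> ((\<lambda>r. f (z + t *\<^sub>R e + r *\<^sub>R e)) has_vector_derivative d (z + t *\<^sub>R e)) (at 0)"
    and "\<And>t. t \<in> closed_segment 0 s \<Longrightarrow> norm (d (z + t *\<^sub>R e) - c) \<le> \<epsilon>"
  shows "norm (f (z + s *\<^sub>R e) - f z - s *\<^sub>R c) \<le> \<epsilon> * \<bar>s\<bar>"
proof -
  define G where "G t = f (z + t *\<^sub>R e) - t *\<^sub>R c" for t
  have "norm (G s - G 0) \<le> \<epsilon> * norm (s - 0)"
  proof (rule differentiable_bound[where S = "closed_segment 0 s" and f' = "\<lambda>t r. r *\<^sub>R (d (z + t *\<^sub>R e) - c)"])
    fix t assume t: "t \<in> closed_segment 0 s"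
    have "(G has_vector_derivative d (z + t *\<^sub>R e) - c) (at t)"
      unfolding G_def
      by (rule has_vector_derivative_diff[OF partial_shift[OF assms(1)[OF t]]]) (auto intro!: derivative_eq_intros)
    then show "(G has_derivative (\<lambda>r. r *\<^sub>R (d (z + t *\<^sub>R e) - c))) (at t within closed_segment 0 s)"
      by (simp add: has_vector_derivative_def has_derivative_at_withinI)
    show "onorm (\<lambda>r. r *\<^sub>R (d (z + t *\<^sub>R e) - c)) \<le> \<epsilon>"
      using assms(2)[OF t] by (intro onorm_le) (simp add: mult.commute[of \<epsilon>] mult_left_mono)
  qed auto
  then show ?thesis by (simp add: G_def algebra_simps)
qed

text \<open>This keeps a path along coordinate directions from x to y inside the ball around x that
  y determines.\<close>

lemma norm_ebas_sum_le:
  assumes "m \<le> 8"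
  shows "norm (\<Sum>l<m. ocomp v l *\<^sub>R ebas l) \<le> norm v"
proof -
  have *: "(norm (\<Sum>l<m. ocomp v l *\<^sub>R ebas l))\<^sup>2 = (\<Sum>l<m. (ocomp v l)\<^sup>2)" if "m \<le> 8" for m v
  proof -
    have "ebas i \<bullet> ebas j = (if i = j then 1 else 0)" if "i < 8" "j < 8" for i j
      using ocomp_ebas[OF that] ocomp_ebas[OF that(2,1)] by (auto simp: ebas_def ocomp_def inner_axis')
    then have "(\<Sum>i<m. \<Sum>j<m. ocomp v i * (ocomp v j * (ebas j \<bullet> ebas i)))
      = (\<Sum>i<m. \<Sum>j<m. if i = j then (ocomp v i)\<^sup>2 else 0)"
      using \<open>m \<le> 8\<close> by (intro sum.cong refl) (auto simp: power2_eq_square)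
    then show ?thesis
      by (simp add: power2_norm_eq_inner inner_sum_left inner_sum_right sum_distrib_left)
  qed
  have "(\<Sum>l<m. (ocomp v l)\<^sup>2) \<le> (\<Sum>l<8. (ocomp v l)\<^sup>2)"
    using assms by (intro sum_mono2) auto
  then have "(norm (\<Sum>l<m. ocomp v l *\<^sub>R ebas l))\<^sup>2 \<le> (norm v)\<^sup>2"
    using *[OF assms, of v] *[of 8 v] by (simp add: ebas_expand)
  then show ?thesis by (rule power2_le_imp_le) simp
qed

lemma abs_ocomp_le: "\<bar>ocomp v l\<bar> \<le> norm v"
  by (simp add: ocomp_def component_le_norm_cart)

text \<open>The chain rule for f(x + \<delta> V(x)) needs a total derivative, while
  \<open>Ck\<close> speaks of partial ones. The increment is split along the coordinate path, each
  of the 8 steps costing \<epsilon>/8.\<close>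

lemma partials_has_derivative:
  fixes f :: "real^8 \<Rightarrow> 'b::real_normed_vector"
  assumes U: "open U" and f: "has_partials U f g" and x: "x \<in> U"
  shows "(f has_derivative (\<lambda>v. \<Sum>l<8. ocomp v l *\<^sub>R g l x)) (at x)"
  unfolding has_derivative_at_alt
proof (intro conjI allI impI)
  have "linear (\<lambda>v. \<Sum>l<8. ocomp v l *\<^sub>R g l x)"
    by (rule linearI) (simp_all add: ocomp_def scaleR_left_distrib sum.distrib scaleR_sum_right)
  then show "bounded_linear (\<lambda>v. \<Sum>l<8. ocomp v l *\<^sub>R g l x)"
    by (simp add: linear_conv_bounded_linear)
  fix \<epsilon> :: real assume \<epsilon>: "0 < \<epsilon>"
  have "\<forall>\<^sub>F y in at x. dist (g l y) (g l x) < \<epsilon> / 8" if "l < 8" for l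
    using f U x that \<epsilon> unfolding has_partials_def
    by (intro tendstoD) (auto simp: continuous_on_eq_continuous_at continuous_at)
  then have "\<forall>\<^sub>F y in at x. \<forall>l\<in>{..<8}. dist (g l y) (g l x) < \<epsilon> / 8"
    by (intro eventually_ball_finite) auto
  then obtain r where r: "r > 0" "\<And>y l. y \<noteq> x \<Longrightarrow> dist y x < r \<Longrightarrow> l < 8 \<Longrightarrow> dist (g l y) (g l x) < \<epsilon> / 8"
    unfolding eventually_at by blast
  obtain r' where r': "r' > 0" "ball x r' \<subseteq> U" using U x open_contains_ball by blast
  show "\<exists>d>0. \<forall>y. norm (y - x) < d \<longrightarrow> norm (f y - f x - (\<Sum>l<8. ocomp (y - x) l *\<^sub>R g l x)) \<le> \<epsilon> * norm (y - x)"
  proof (intro exI[of _ "min r r'"] conjI allI impI)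
    fix y assume y: "norm (y - x) < min r r'"
    define v where "v = y - x"
    define P where "P m = x + (\<Sum>l<m. ocomp v l *\<^sub>R ebas l)" for m
    have step: "norm (f (P (Suc m)) - f (P m) - ocomp v m *\<^sub>R g m x) \<le> \<epsilon> / 8 * norm v" if m: "m < 8" for m
    proof -
      have near: "dist (P m + t *\<^sub>R ebas m) x < min r r'" if t: "t \<in> closed_segment 0 (ocomp v m)" for t
      proof -
        obtain s where s: "0 \<le> s" "s \<le> 1" "t = s * ocomp v m"
          using t by (auto simp: in_segment)
        \<comment> \<open>A point of the m-th segment is a convex combination of two partial sums of
          the expansion of \<open>v\<close>.\<close>
        have "P m + t *\<^sub>R ebas m - x = (1 - s) *\<^sub>R (\<Sum>l<m. ocomp v l *\<^sub>R ebas l) + s *\<^sub>R (\<Sum>l<Suc m. ocomp v l *\<^sub>R ebas l)"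
          by (simp add: P_def s algebra_simps)
        also have "norm \<dots> \<le> (1 - s) * norm v + s * norm v"
          using s m by (intro norm_triangle_le add_mono) (simp_all add: mult_left_mono norm_ebas_sum_le del: sum.lessThan_Suc)
        also have "\<dots> = norm v" by (simp add: algebra_simps)
        finally show ?thesis using y by (simp add: dist_norm v_def)
      qed
      have "norm (f (P m + ocomp v m *\<^sub>R ebas m) - f (P m) - ocomp v m *\<^sub>R g m x) \<le> \<epsilon> / 8 * \<bar>ocomp v m\<bar>"
      proof (rule partial_increment_bound[where d = "g m"])
        fix t assume t: "t \<in> closed_segment 0 (ocomp v m)"
        have "P m + t *\<^sub>R ebas m \<in> U" using near[OF t] r'(2) by (auto simp: dist_commute)
        then show "((\<lambda>r. f (P m + t *\<^sub>R ebas m + r *\<^sub>R ebas m)) has_vector_derivative g m (P m + t *\<^sub>R ebas m)) (at 0)"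
          using f m unfolding has_partials_def by blast
        show "norm (g m (P m + t *\<^sub>R ebas m) - g m x) \<le> \<epsilon> / 8"
          using r(2)[of "P m + t *\<^sub>R ebas m" m] near[OF t] m \<epsilon>
          by (cases "P m + t *\<^sub>R ebas m = x") (auto simp: dist_norm less_imp_le)
      qed
      also have "\<dots> \<le> \<epsilon> / 8 * norm v" using \<epsilon> abs_ocomp_le by (intro mult_left_mono) auto
      finally show ?thesis by (simp add: P_def add.assoc)
    qed
    have "P 8 = y" "P 0 = x" by (simp_all add: P_def ebas_expand v_def)
    then have "f y - f x - (\<Sum>l<8. ocomp v l *\<^sub>R g l x) = (\<Sum>m<8. f (P (Suc m)) - f (P m) - ocomp v m *\<^sub>R g m x)"
      using sum_lessThan_telescope[of "\<lambda>m. f (P m)" 8] by (simp only: sum_subtractf)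
    also have "norm \<dots> \<le> (\<Sum>m<(8::nat). \<epsilon> / 8 * norm v)"
      using step by (intro sum_norm_le) auto
    finally show "norm (f y - f x - (\<Sum>l<8. ocomp (y - x) l *\<^sub>R g l x)) \<le> \<epsilon> * norm (y - x)"
      by (simp add: v_def)
  qed (use r r' in auto)
qed

text \<open>The partial derivatives are uniformly continuous on a compact neighbourhood of
  \<open>K\<close>. Points off \<open>K\<close> are included because lattice points outside the
  closure of the domain must be covered.\<close>

lemma Dh_near_Dirac:
  assumes K: "compact K" "K \<noteq> {}" and N: "open N" "K \<subseteq> N"
    and f: "has_partials N f g" and \<eta>: "0 < \<eta>"
    and small: "\<And>x. x \<in> N \<Longrightarrow> norm (\<Sum>l<8. omult (ebas l) (g l x)) \<le> \<eta>"
  shows "\<exists>\<rho>>0. \<exists>h0>0. \<forall>h x. 0 < h \<longrightarrow> h < h0 \<longrightarrow> infdist x K \<le> \<rho> \<longrightarrow> norm (Dh h f x) \<le> 2 * \<eta>"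
proof -
  obtain c where c: "c > 0" "\<And>l q. l < 8 \<Longrightarrow> norm (omult (ebas l) q) \<le> (c::real) * norm q"
    using omult_ebas_bound by blast
  obtain e where e: "e > 0" "{x. infdist x K \<le> e} \<subseteq> N"
    using compact_in_open_separated[OF K(2,1) N] by blast
  define K' where "K' = {x. infdist x K \<le> e}"
  have cK': "compact K'" unfolding K'_def using K e by (intro compact_infdist_le) auto
  define \<epsilon> where "\<epsilon> = \<eta> / (8 * c)"
  have \<epsilon>: "\<epsilon> > 0" using \<eta> c by (simp add: \<epsilon>_def)
  have "\<exists>d>0. \<forall>x\<in>K'. \<forall>y\<in>K'. dist y x < d \<longrightarrow> dist (g l y) (g l x) < \<epsilon>" if "l < 8" for l
  proof -
    have "continuous_on K' (g l)" using f that e(2) unfolding has_partials_def K'_def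
      by (meson continuous_on_subset)
    then have "uniformly_continuous_on K' (g l)" using cK' by (rule compact_uniformly_continuous)
    then show ?thesis using \<epsilon> unfolding uniformly_continuous_on_def by blast
  qed
  then have "\<forall>l. \<exists>d>0. l < 8 \<longrightarrow> (\<forall>x\<in>K'. \<forall>y\<in>K'. dist y x < d \<longrightarrow> dist (g l y) (g l x) < \<epsilon>)"
    using zero_less_one by blast
  then obtain d where "\<forall>l. d l > 0 \<and> (l < 8 \<longrightarrow> (\<forall>x\<in>K'. \<forall>y\<in>K'. dist y x < d l \<longrightarrow> dist (g l y) (g l x) < \<epsilon>))"
    by (rule choice[THEN exE])
  then have d: "\<And>l. d l > 0"
    "\<And>l x y. l < 8 \<Longrightarrow> x \<in> K' \<Longrightarrow> y \<in> K' \<Longrightarrow> dist y x < d l \<Longrightarrow> dist (g l y) (g l x) < \<epsilon>"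
    by blast+
  \<comment> \<open>A stencil of size below e/2 centred within e/2 of \<open>K\<close> stays in the
    neighbourhood of radius e.\<close>
  define h0 where "h0 = min (e / 2) (Min (d ` {..<8}))"
  have h0: "h0 > 0" "\<And>l. l < 8 \<Longrightarrow> h0 \<le> d l"
  proof -
    have "{..<8::nat} \<noteq> {}" by (metis lessThan_iff empty_iff zero_less_numeral)
    then show "h0 > 0" using e d(1) by (auto simp: h0_def)
    show "h0 \<le> d l" if "l < 8" for l unfolding h0_def using that by (intro min.coboundedI2 Min_le) auto
  qed
  have "norm (Dh h f x) \<le> 2 * \<eta>" if h: "0 < h" "h < h0" and x: "infdist x K \<le> e / 2" for h x
  proof -
    have xK': "x \<in> K'" using x e by (simp add: K'_def)
    have q: "norm ((1 / (2 * h)) *\<^sub>R (f (x + h *\<^sub>R ebas l) - f (x - h *\<^sub>R ebas l)) - g l x) \<le> \<epsilon>" if l: "l < 8" for l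
    proof -
      define z where "z = x - h *\<^sub>R ebas l"
      have pt: "z + t *\<^sub>R ebas l \<in> K'" "dist (z + t *\<^sub>R ebas l) x < d l" if "t \<in> closed_segment 0 (2 * h)" for t
      proof -
        have "z + t *\<^sub>R ebas l - x = (t - h) *\<^sub>R ebas l" by (simp add: z_def algebra_simps)
        then have "dist (z + t *\<^sub>R ebas l) x = \<bar>t - h\<bar>" by (simp add: dist_norm)
        also have "\<dots> \<le> h" using that h by (auto simp: closed_segment_eq_real_ivl abs_le_iff)
        finally have D: "dist (z + t *\<^sub>R ebas l) x \<le> h" .
        then show "dist (z + t *\<^sub>R ebas l) x < d l" using h h0(2)[OF l] by linarith
        have "h < e / 2" using h by (simp add: h0_def)
        then show "z + t *\<^sub>R ebas l \<in> K'"
          using infdist_triangle[of "z + t *\<^sub>R ebas l" K x] D x by (simp add: K'_def)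
      qed
      have b: "norm (f (z + (2 * h) *\<^sub>R ebas l) - f z - (2 * h) *\<^sub>R g l x) \<le> \<epsilon> * \<bar>2 * h\<bar>"
      proof (rule partial_increment_bound[where d = "g l"])
        fix t assume t: "t \<in> closed_segment 0 (2 * h)"
        show "((\<lambda>r. f (z + t *\<^sub>R ebas l + r *\<^sub>R ebas l)) has_vector_derivative g l (z + t *\<^sub>R ebas l)) (at 0)"
          using f l pt(1)[OF t] e(2) unfolding has_partials_def K'_def by blast
        show "norm (g l (z + t *\<^sub>R ebas l) - g l x) \<le> \<epsilon>"
          using d(2)[OF l xK' pt[OF t]] by (simp add: dist_norm)
      qed
      have zeq: "z + (2 * h) *\<^sub>R ebas l = x + h *\<^sub>R ebas l"
        unfolding z_def mult_2 scaleR_left.add by simp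
      have b2: "norm (f (x + h *\<^sub>R ebas l) - f (x - h *\<^sub>R ebas l) - (2 * h) *\<^sub>R g l x) \<le> \<epsilon> * (2 * h)"
        using b h unfolding zeq by (simp add: z_def)
      have eq: "(1 / (2 * h)) *\<^sub>R (f (x + h *\<^sub>R ebas l) - f (x - h *\<^sub>R ebas l)) - g l x
          = (1 / (2 * h)) *\<^sub>R (f (x + h *\<^sub>R ebas l) - f (x - h *\<^sub>R ebas l) - (2 * h) *\<^sub>R g l x)"
        using h by (simp add: scaleR_diff_right)
      show ?thesis
        unfolding eq norm_scaleR using mult_left_mono[OF b2, of "1 / (2 * h)"] h by simp
    qed
    have "Dh h f x - (\<Sum>l<8. omult (ebas l) (g l x))
        = (\<Sum>l<8. omult (ebas l) ((1 / (2 * h)) *\<^sub>R (f (x + h *\<^sub>R ebas l) - f (x - h *\<^sub>R ebas l)) - g l x))"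
      unfolding Dh_def linear_diff[OF omult_linear] by (simp only: sum_subtractf)
    also have "norm \<dots> \<le> (\<Sum>l<(8::nat). c * \<epsilon>)"
    proof (rule sum_norm_le)
      fix l :: nat assume "l \<in> {..<8}"
      then have l: "l < 8" by simp
      show "norm (omult (ebas l) ((1 / (2 * h)) *\<^sub>R (f (x + h *\<^sub>R ebas l) - f (x - h *\<^sub>R ebas l)) - g l x)) \<le> c * \<epsilon>"
        using c(2)[OF l] mult_left_mono[OF q[OF l], of c] c(1) by (meson less_imp_le order_trans)
    qed
    also have "\<dots> = \<eta>" using c by (simp add: \<epsilon>_def)
    finally have "norm (Dh h f x - (\<Sum>l<8. omult (ebas l) (g l x))) \<le> \<eta>" .
    moreover have "x \<in> N" using xK' e(2) by (auto simp: K'_def)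
    ultimately show ?thesis
      using small[of x] norm_triangle_sub[of "Dh h f x" "\<Sum>l<8. omult (ebas l) (g l x)"] by linarith
  qed
  then show ?thesis using e h0(1) by (intro exI[of _ "e / 2"] conjI exI[of _ h0]) auto
qed

subsection \<open>Pushing the closure of the domain into its interior\<close>

text \<open>Some partial derivative of the defining function is nonzero at \<open>p\<close> and, by
  continuity, stays away from 0 nearby. Moving along that coordinate axis with the right sign
  strictly decreases the function, which is at most 0 on the closure. A transversal axis thus does
  the work of the normal.\<close>

lemma C3_domain_translate:
  assumes B: "C3_domain B" and p: "p \<in> frontier B"
  shows "\<exists>r>0. \<exists>s>0. \<exists>\<nu>. norm \<nu> = 1 \<and> (\<forall>x\<in>closure B \<inter> ball p r. \<forall>t. 0 < t \<longrightarrow> t < s \<longrightarrow> x + t *\<^sub>R \<nu> \<in> B)"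
proof -
  obtain r0 \<phi> \<phi>' where r0: "r0 > 0" and C: "Ck 3 UNIV UNIV \<phi>"
    and \<phi>': "(\<phi> has_derivative \<phi>') (at p)" "\<phi>' \<noteq> (\<lambda>_. 0)"
    and eq: "B \<inter> ball p r0 = {x \<in> ball p r0. \<phi> x < (0::real)}"
    using B p unfolding C3_domain_def by blast
  have cont: "continuous_on UNIV \<phi>" using C by (rule Ck_continuous)
  obtain d where "has_partials UNIV \<phi> d"
    using Ck_has_partials[of 2 UNIV UNIV \<phi>] C by (auto simp: numeral_3_eq_3 numeral_2_eq_2)
  then have d: "\<And>l x. l < 8 \<Longrightarrow> ((\<lambda>t. \<phi> (x + t *\<^sub>R ebas l)) has_vector_derivative d l x) (at 0)"
    "\<And>l. l < 8 \<Longrightarrow> continuous_on UNIV (d l)"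
    unfolding has_partials_def by blast+
  have lin: "linear \<phi>'" using \<phi>'(1) by (rule has_derivative_linear)
  have dp: "d l p = \<phi>' (ebas l)" if "l < 8" for l
  proof -
    have "((\<lambda>t. p + t *\<^sub>R ebas l) has_derivative (\<lambda>t. t *\<^sub>R ebas l)) (at 0)"
      by (auto intro!: derivative_eq_intros)
    from diff_chain_at[OF this, of \<phi> \<phi>'] \<phi>'(1)
    have "((\<lambda>t. \<phi> (p + t *\<^sub>R ebas l)) has_vector_derivative \<phi>' (ebas l)) (at 0)"
      by (simp add: o_def has_vector_derivative_def linear_scale[OF lin])
    then show ?thesis using d(1)[OF that, of p] by (rule vector_derivative_unique_at[rotated])
  qed
  have "\<exists>l<8. d l p \<noteq> 0"
  proof (rule ccontr)
    assume "\<not> (\<exists>l<8. d l p \<noteq> 0)"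
    then have z: "\<phi>' (ebas l) = 0" if "l < 8" for l using dp that by auto
    have e: "\<phi>' v = (\<Sum>l<8. ocomp v l *\<^sub>R \<phi>' (ebas l))" for v
      using linear_sum[OF lin, of "\<lambda>l. ocomp v l *\<^sub>R ebas l" "{..<8}"]
      by (simp add: ebas_expand linear_scale[OF lin])
    have "\<phi>' v = 0" for v
      unfolding e[of v] by (intro sum.neutral) (simp add: z)
    then have "\<phi>' = (\<lambda>_. 0)" by blast
    with \<phi>'(2) show False by simp
  qed
  then obtain l where l: "l < 8" "d l p \<noteq> 0" by blast
  define \<sigma> where "\<sigma> = sgn (d l p)"
  have sg: "\<bar>\<sigma>\<bar> = 1" "\<sigma> * d l p = \<bar>d l p\<bar>"
    using l(2) by (auto simp: \<sigma>_def sgn_if)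
  have "\<forall>\<^sub>F y in at p. dist (d l y) (d l p) < \<bar>d l p\<bar> / 2"
    using d(2)[OF l(1)] l(2) by (intro tendstoD) (auto simp: continuous_on_eq_continuous_at continuous_at)
  then obtain r1 where r1: "r1 > 0" "\<And>y. y \<noteq> p \<Longrightarrow> dist y p < r1 \<Longrightarrow> dist (d l y) (d l p) < \<bar>d l p\<bar> / 2"
    unfolding eventually_at by blast
  \<comment> \<open>Halving leaves room for a translation of length below \<open>r\<close> that
    starts within \<open>r\<close> of \<open>p\<close>.\<close>
  define r where "r = min r0 r1 / 2"
  have r: "r > 0" "2 * r \<le> r0" "2 * r \<le> r1" using r0 r1 by (auto simp: r_def)
  define \<nu> where "\<nu> = (- \<sigma>) *\<^sub>R ebas l"
  have "x + t *\<^sub>R \<nu> \<in> B" if x: "x \<in> closure B" "x \<in> ball p r" and t: "0 < t" "t < r" for x t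
  proof -
    have \<phi>x: "\<phi> x \<le> 0"
    proof -
      have "x \<in> ball p r0" using x r by auto
      then have "x \<in> closure (ball p r0 \<inter> B)"
        using open_Int_closure_subset[OF open_ball, of p r0 B] x by blast
      moreover have "closure (ball p r0 \<inter> B) \<subseteq> {x. \<phi> x \<le> 0}"
      proof (rule closure_minimal)
        show "ball p r0 \<inter> B \<subseteq> {x. \<phi> x \<le> 0}" using eq by (auto intro: less_imp_le)
        show "closed {x. \<phi> x \<le> 0}" using cont by (intro closed_Collect_le) auto
      qed
      ultimately show ?thesis by blast
    qed
    define s where "s = t * (- \<sigma>)"
    have abs_s: "\<bar>s\<bar> = t" using t sg(1) by (simp add: s_def abs_mult)
    have near: "dist (x + q *\<^sub>R ebas l) p < 2 * r" if "q \<in> closed_segment 0 s" for q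
    proof -
      have "\<bar>q\<bar> \<le> \<bar>s\<bar>" using that by (auto simp: closed_segment_eq_real_ivl split: if_splits)
      then have "dist (x + q *\<^sub>R ebas l) x < r" using t abs_s by (simp add: dist_norm)
      moreover have "dist x p < r" using x by (simp add: dist_commute)
      ultimately show ?thesis using dist_triangle[of "x + q *\<^sub>R ebas l" p x] by linarith
    qed
    have bd: "norm (\<phi> (x + s *\<^sub>R ebas l) - \<phi> x - s *\<^sub>R d l p) \<le> \<bar>d l p\<bar> / 2 * \<bar>s\<bar>"
    proof (rule partial_increment_bound[where d = "d l"])
      fix q assume q: "q \<in> closed_segment 0 s"
      show "((\<lambda>r. \<phi> (x + q *\<^sub>R ebas l + r *\<^sub>R ebas l)) has_vector_derivative d l (x + q *\<^sub>R ebas l)) (at 0)"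
        using d(1)[OF l(1)] .
      show "norm (d l (x + q *\<^sub>R ebas l) - d l p) \<le> \<bar>d l p\<bar> / 2"
        using r1(2)[of "x + q *\<^sub>R ebas l"] near[OF q] r(3)
        by (cases "x + q *\<^sub>R ebas l = p") (auto simp: dist_norm less_imp_le)
    qed
    have sd: "s * d l p = - (t * \<bar>d l p\<bar>)" using sg(2) by (simp add: s_def algebra_simps)
    have "\<bar>\<phi> (x + s *\<^sub>R ebas l) - \<phi> x + t * \<bar>d l p\<bar>\<bar> \<le> (t * \<bar>d l p\<bar>) / 2"
      using bd by (simp add: sd abs_s mult.commute)
    moreover have "0 < t * \<bar>d l p\<bar>" using t l by simp
    ultimately have "\<phi> (x + s *\<^sub>R ebas l) < 0" using \<phi>x by linarith
    moreover have "x + s *\<^sub>R ebas l \<in> ball p r0" using near[of s] r by (auto simp: dist_commute)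
    moreover have "x + t *\<^sub>R \<nu> = x + s *\<^sub>R ebas l" by (simp add: \<nu>_def s_def)
    ultimately show ?thesis using eq by auto
  qed
  moreover have "norm \<nu> = 1" using sg by (simp add: \<nu>_def)
  ultimately show ?thesis using r(1) by (intro exI[of _ r] conjI exI[of _ \<nu>]) auto
qed

section \<open>A C^1 bump function with explicit partial derivatives\<close>

lemma has_derivative_pos_part_sq:
  "((\<lambda>s. (max 0 s)\<^sup>2) has_real_derivative 2 * max 0 s) (at s)" for s :: real
proof (cases s "0::real" rule: linorder_cases)
  case less
  have "((\<lambda>s. 0) has_real_derivative 2 * max 0 s) (at s)" using less by simp
  then show ?thesis
    by (rule has_field_derivative_transform_within_open[of _ _ _ "{..<0}"]) (use less in auto)
next
  case greater
  have "((\<lambda>s. s\<^sup>2) has_real_derivative 2 * max 0 s) (at s)"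
    using greater by (auto intro!: derivative_eq_intros)
  then show ?thesis
    by (rule has_field_derivative_transform_within_open[of _ _ _ "{0<..}"]) (use greater in auto)
next
  case equal
  have "(\<lambda>h. (max 0 h)\<^sup>2 / h) \<midarrow>0\<rightarrow> (0::real)"
  proof (rule Lim_null_comparison)
    show "\<forall>\<^sub>F h in at 0. norm ((max 0 h)\<^sup>2 / h) \<le> \<bar>h\<bar>" for h :: real
      by (rule always_eventually) (auto simp: max_def power2_eq_square)
    show "((\<lambda>h::real. \<bar>h\<bar>) \<longlongrightarrow> 0) (at 0)" by (rule tendsto_rabs_zero tendsto_ident_at)+
  qed
  then show ?thesis unfolding DERIV_def by (simp add: equal)
qed

text \<open>The square of a positive part is C^1 with a derivative in closed form, and only first
  derivatives of the vector field enter the estimates.\<close>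

definition bump :: "real^8 \<Rightarrow> real \<Rightarrow> real^8 \<Rightarrow> real" where
  "bump p a x = (max 0 (1 - (norm (x - p))\<^sup>2 / a\<^sup>2))\<^sup>2"

definition bump_partial :: "real^8 \<Rightarrow> real \<Rightarrow> nat \<Rightarrow> real^8 \<Rightarrow> real" where
  "bump_partial p a l x = 2 * max 0 (1 - (norm (x - p))\<^sup>2 / a\<^sup>2) * (- (2 * ((x - p) \<bullet> ebas l)) / a\<^sup>2)"

lemma bump_has_partial:
  "((\<lambda>t. bump p a (x + t *\<^sub>R ebas l)) has_vector_derivative bump_partial p a l x) (at 0)"
proof -
  define q where "q t = 1 - (norm (x + t *\<^sub>R ebas l - p))\<^sup>2 / a\<^sup>2" for t
  have "q t = 1 - ((norm (x - p))\<^sup>2 + 2 * t * ((x - p) \<bullet> ebas l) + t\<^sup>2) / a\<^sup>2" for t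
    using norm_ebas[of l, unfolded norm_eq_1] unfolding q_def power2_norm_eq_inner
    by (simp add: inner_add inner_diff power2_eq_square algebra_simps inner_commute)
  then have "q = (\<lambda>t. 1 - ((norm (x - p))\<^sup>2 + 2 * t * ((x - p) \<bullet> ebas l) + t\<^sup>2) / a\<^sup>2)" by auto
  then have "(q has_real_derivative - (2 * ((x - p) \<bullet> ebas l)) / a\<^sup>2) (at 0)"
    by (auto intro!: derivative_eq_intros simp: divide_inverse)
  from DERIV_chain2[OF has_derivative_pos_part_sq this]
  show ?thesis
    by (simp add: bump_def bump_partial_def q_def has_real_derivative_iff_has_vector_derivative)
qed

lemma continuous_bump: "continuous_on UNIV (bump p a)"
  unfolding bump_def by (cases "a = 0") (auto intro!: continuous_intros)

lemma continuous_bump_partial: "continuous_on UNIV (bump_partial p a l)"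
  unfolding bump_partial_def by (cases "a = 0") (auto intro!: continuous_intros)

lemma bump_bounds: "0 \<le> bump p a x" "bump p a x \<le> 1"
  by (auto simp: bump_def intro!: power_le_one)

lemma bump_pos_iff:
  assumes "0 < a"
  shows "0 < bump p a x \<longleftrightarrow> norm (x - p) < a"
proof -
  have "0 < (max 0 q)\<^sup>2 \<longleftrightarrow> 0 < q" for q :: real by (auto simp: max_def)
  then have "0 < bump p a x \<longleftrightarrow> (norm (x - p))\<^sup>2 / a\<^sup>2 < 1"
    by (simp only: bump_def diff_gt_0_iff_gt)
  also have "\<dots> \<longleftrightarrow> (norm (x - p))\<^sup>2 < a\<^sup>2"
    using assms by (intro divide_less_eq_1_pos) simp
  also have "\<dots> \<longleftrightarrow> norm (x - p) < a"
    using assms by (metis norm_ge_zero power2_less_imp_less power_strict_mono zero_less_numeral less_imp_le)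
  finally show ?thesis .
qed

text \<open>Finitely many charts cover the compact frontier, and the field is the sum of their
  inward directions weighted by bumps. At a frontier point some bump is positive; points of the
  domain are never pushed out of it.\<close>

lemma push_field:
  assumes B: "C3_domain B"
  shows "\<exists>V W \<delta>0. has_partials UNIV V W \<and> continuous_on UNIV V \<and> 0 < \<delta>0 \<and>
    (\<forall>\<delta> x. 0 < \<delta> \<longrightarrow> \<delta> < \<delta>0 \<longrightarrow> x \<in> closure B \<longrightarrow> x + \<delta> *\<^sub>R (V x :: real^8) \<in> B)"
proof -
  obtain r s \<nu> where r: "\<And>p. p \<in> frontier B \<Longrightarrow> r p > 0" and s: "\<And>p. p \<in> frontier B \<Longrightarrow> s p > 0"
    and \<nu>: "\<And>p. p \<in> frontier B \<Longrightarrow> norm (\<nu> p) = 1"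
    and tr: "\<And>p x t. p \<in> frontier B \<Longrightarrow> x \<in> closure B \<Longrightarrow> x \<in> ball p (r p) \<Longrightarrow> 0 < t \<Longrightarrow> t < s p \<Longrightarrow> x + t *\<^sub>R \<nu> p \<in> B"
    using C3_domain_translate[OF B] by (metis IntI)
  have opB: "open B" and bdB: "bounded B" using B by (auto simp: C3_domain_def)
  have cB: "compact (frontier B)" using bdB by (rule compact_frontier_bounded)
  have cov: "frontier B \<subseteq> (\<Union>p\<in>frontier B. ball p (r p / 2))" using r by force
  obtain I where I: "I \<subseteq> frontier B" "finite I" "frontier B \<subseteq> (\<Union>p\<in>I. ball p (r p / 2))"
    by (rule compactE_image[OF cB open_ball cov])
  define b where "b p = bump p (r p / 2)" for p
  define VJ where "VJ J x = (\<Sum>p\<in>J. b p x *\<^sub>R \<nu> p)" for J x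
  define W where "W l x = (\<Sum>p\<in>I. bump_partial p (r p / 2) l x *\<^sub>R \<nu> p)" for l x
  \<comment> \<open>Any partial sum of the field has norm at most \<open>card I\<close>, so it moves
    a point of the half-size ball by less than \<open>r p / 2\<close> and stays in the chart. The
    element 1 makes the set visibly nonempty.\<close>
  define \<delta>0 where "\<delta>0 = Min (insert 1 ((\<lambda>p. min (s p) (r p / 2 / (real (card I) + 1))) ` I))"
  have "0 < \<delta>0"
    unfolding \<delta>0_def using I r s by (subst Min_gr_iff) (auto intro!: divide_pos_pos)
  have \<delta>0: "\<delta>0 \<le> s p" "\<delta>0 \<le> r p / 2 / (real (card I) + 1)" if "p \<in> I" for p
  proof -
    have "\<delta>0 \<le> min (s p) (r p / 2 / (real (card I) + 1))"
      unfolding \<delta>0_def using I that by (intro Min_le) auto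
    then show "\<delta>0 \<le> s p" "\<delta>0 \<le> r p / 2 / (real (card I) + 1)" by auto
  qed
  have b_pos: "0 < b p x \<longleftrightarrow> x \<in> ball p (r p / 2)" if "p \<in> I" for p x
    using bump_pos_iff[of "r p / 2" p x] r[of p] I that by (auto simp: b_def dist_norm norm_minus_commute)
  have "x + \<delta> *\<^sub>R VJ I x \<in> B" if \<delta>: "0 < \<delta>" "\<delta> < \<delta>0" and x: "x \<in> closure B" for \<delta> x
  proof -
    txt \<open>The summands of the field are applied one after the other, so that each of them only needs
      its own chart and the different inward directions never have to be compared.\<close>
    have "x + \<delta> *\<^sub>R VJ J x \<in> closure B \<and> (x \<in> B \<or> (\<exists>p\<in>J. 0 < b p x) \<longrightarrow> x + \<delta> *\<^sub>R VJ J x \<in> B)" if "J \<subseteq> I" for J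
      using finite_subset[OF that I(2)] that
    proof (induction J rule: finite_induct)
      case empty
      then show ?case using x by (simp add: VJ_def)
    next
      case (insert p J)
      define y where "y = x + \<delta> *\<^sub>R VJ J x"
      have y: "y \<in> closure B" "x \<in> B \<or> (\<exists>p\<in>J. 0 < b p x) \<Longrightarrow> y \<in> B"
        using insert by (auto simp: y_def)
      have pI: "p \<in> I" "p \<in> frontier B" using insert.prems I by auto
      have step: "x + \<delta> *\<^sub>R VJ (insert p J) x = y + (\<delta> * b p x) *\<^sub>R \<nu> p"
        using insert.hyps by (simp add: VJ_def y_def algebra_simps)
      show ?case
      proof (cases "0 < b p x")
        case False
        then have "b p x = 0" using bump_bounds(1)[of p "r p / 2" x] by (simp add: b_def)
        then show ?thesis using y unfolding step by auto
      next
        case True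
        have "norm (VJ J x) \<le> (\<Sum>p\<in>J. 1)"
          unfolding VJ_def
        proof (rule sum_norm_le)
          fix p assume "p \<in> J"
          then have "p \<in> frontier B" using insert.prems I by auto
          then show "norm (b p x *\<^sub>R \<nu> p) \<le> 1"
            using bump_bounds[of p "r p / 2" x] \<nu> by (simp add: b_def)
        qed
        also have "\<dots> \<le> real (card I)" using insert.prems I(2) by (simp add: card_mono)
        finally have "\<delta> * norm (VJ J x) \<le> \<delta> * real (card I)" using \<delta> by (intro mult_left_mono) auto
        also have "\<dots> < \<delta> * (real (card I) + 1)" using \<delta> by simp
        also have "\<dots> < \<delta>0 * (real (card I) + 1)" using \<delta>(2) by (intro mult_strict_right_mono) auto
        also have "\<dots> \<le> r p / 2" using \<delta>0(2)[OF pI(1)] by (simp add: pos_le_divide_eq algebra_simps)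
        finally have "dist y x < r p / 2" using \<delta> by (simp add: y_def dist_norm)
        moreover have "dist p x < r p / 2" using True b_pos[OF pI(1)] by simp
        ultimately have yb: "y \<in> ball p (r p)" using dist_triangle2[of p y x] by simp
        have "\<delta> * b p x \<le> \<delta> * 1" using bump_bounds(2) \<delta> by (intro mult_left_mono) (auto simp: b_def)
        then have "\<delta> * b p x < s p" using \<delta> \<delta>0(1)[OF pI(1)] by linarith
        then have "y + (\<delta> * b p x) *\<^sub>R \<nu> p \<in> B" using tr[OF pI(2) y(1) yb] True \<delta> by simp
        then show ?thesis unfolding step using closure_subset by blast
      qed
    qed
    from this[of I] have "x \<in> B \<or> (\<exists>p\<in>I. 0 < b p x) \<Longrightarrow> x + \<delta> *\<^sub>R VJ I x \<in> B" by blast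
    moreover have "x \<in> B \<or> (\<exists>p\<in>I. 0 < b p x)"
    proof (cases "x \<in> B")
      case False
      then have "x \<in> frontier B" using x opB by (simp add: frontier_def interior_open)
      then show ?thesis using I(3) b_pos by blast
    qed simp
    ultimately show ?thesis by blast
  qed
  moreover have "continuous_on UNIV (VJ I)"
    unfolding VJ_def b_def by (intro continuous_intros continuous_bump)
  moreover have "has_partials UNIV (VJ I) W"
    unfolding has_partials_def VJ_def W_def b_def
  proof (intro allI impI conjI ballI)
    fix l :: nat and x :: "real^8"
    show "continuous_on UNIV (\<lambda>x. \<Sum>p\<in>I. bump_partial p (r p / 2) l x *\<^sub>R \<nu> p)"
      by (intro continuous_intros continuous_bump_partial)
    show "((\<lambda>t. \<Sum>p\<in>I. bump p (r p / 2) (x + t *\<^sub>R ebas l) *\<^sub>R \<nu> p) has_vector_derivative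
       (\<Sum>p\<in>I. bump_partial p (r p / 2) l x *\<^sub>R \<nu> p)) (at 0)"
    proof (rule has_vector_derivative_sum)
      fix p
      show "((\<lambda>t. bump p (r p / 2) (x + t *\<^sub>R ebas l) *\<^sub>R \<nu> p) has_vector_derivative bump_partial p (r p / 2) l x *\<^sub>R \<nu> p) (at 0)"
        using bump_has_partial[of p "r p / 2" x l]
        by (auto simp: has_vector_derivative_def intro!: derivative_eq_intros)
    qed
  qed
  ultimately show ?thesis using \<open>0 < \<delta>0\<close> by blast
qed

subsection \<open>Approximation by functions that are almost regular beyond the boundary\<close>

lemma compact_uniform_bound:
  assumes "compact K" "\<And>l. l < (8::nat) \<Longrightarrow> continuous_on K (g l)"
  shows "\<exists>A>0. \<forall>l<8. \<forall>x\<in>K. norm (g l x :: 'b::real_normed_vector) \<le> A"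
proof -
  have "bounded (\<Union>l\<in>{..<8}. g l ` K)"
    using assms by (intro bounded_UN) (auto intro!: compact_imp_bounded compact_continuous_image)
  then obtain A where "A > 0" "\<forall>y\<in>(\<Union>l\<in>{..<8}. g l ` K). norm y \<le> A"
    using bounded_pos by metis
  then show ?thesis by auto
qed

text \<open>By the chain rule the partial derivatives of f(x + \<delta> V(x)) are those of f at the
  moved point plus \<delta> times a bounded term. The first contribution to the Dirac operator
  vanishes because the moved point lies in \<open>B\<close>, where f is regular.\<close>

lemma regular_approximation:
  assumes B: "C3_domain B" and cf: "continuous_on (closure B) f" and f: "has_partials B f g"
    and cg: "\<And>l. l < 8 \<Longrightarrow> continuous_on (closure B) (g l)"
    and Df: "\<And>x. x \<in> B \<Longrightarrow> (\<Sum>l<8. omult (ebas l) (g l x)) = 0" and \<eta>: "0 < \<eta>"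
  shows "\<exists>F G N. open N \<and> closure B \<subseteq> N \<and> has_partials N F G \<and>
    (\<forall>x\<in>N. norm (\<Sum>l<8. omult (ebas l) (G l x)) \<le> \<eta>) \<and> (\<forall>x\<in>B. norm (F x - f x) \<le> \<eta>)"
proof -
  obtain V W \<delta>0 where V: "has_partials UNIV V W" "continuous_on UNIV V" and "0 < \<delta>0"
    and push: "\<And>\<delta> x. 0 < \<delta> \<Longrightarrow> \<delta> < \<delta>0 \<Longrightarrow> x \<in> closure B \<Longrightarrow> x + \<delta> *\<^sub>R (V x :: real^8) \<in> B"
    using push_field[OF B] by blast
  have opB: "open B" and cB: "compact (closure B)"
    using B by (auto simp: C3_domain_def compact_closure)
  have cW: "continuous_on S (W l)" if "l < 8" for l S
    using V(1) that unfolding has_partials_def by (meson continuous_on_subset subset_UNIV)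
  obtain c where c: "c > 0" "\<And>l q. l < 8 \<Longrightarrow> norm (omult (ebas l) q) \<le> (c::real) * norm q"
    using omult_ebas_bound by blast
  obtain A1 where A1: "A1 > 0" "\<And>l x. l < 8 \<Longrightarrow> x \<in> closure B \<Longrightarrow> norm (g l x) \<le> A1"
    using compact_uniform_bound[of "closure B" g, OF cB cg] by blast
  obtain A2 where A2: "A2 > 0" "\<And>l x. l < 8 \<Longrightarrow> x \<in> closure B \<Longrightarrow> norm (W l x) \<le> A2"
    using compact_uniform_bound[of "closure B" W, OF cB cW] by blast
  obtain A3 where A3: "A3 > 0" "\<And>x. x \<in> closure B \<Longrightarrow> norm (V x) \<le> A3"
    using compact_uniform_bound[OF cB, of "\<lambda>_. V"] continuous_on_subset[OF V(2)] by (metis subset_UNIV zero_less_numeral)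
  have "uniformly_continuous_on (closure B) f" using cf cB by (rule compact_uniformly_continuous)
  then obtain d where d: "d > 0" "\<And>x y. x \<in> closure B \<Longrightarrow> y \<in> closure B \<Longrightarrow> dist y x < d \<Longrightarrow> dist (f y) (f x) < \<eta>"
    using \<eta> unfolding uniformly_continuous_on_def by metis
  \<comment> \<open>Sum over 8 directions, each with the multiplication constant \<open>c\<close>
    and 8 products of a derivative of the field with one of f.\<close>
  define D where "D = 8 * (c * (8 * ((A2 + 1) * A1)))"
  have D: "D > 0" using c A1 A2 by (simp add: D_def)
  define \<delta> where "\<delta> = min (\<delta>0 / 2) (min (d / (2 * A3)) (\<eta> / D))"
  have \<delta>: "0 < \<delta>" "\<delta> < \<delta>0" "\<delta> \<le> d / (2 * A3)" "\<delta> \<le> \<eta> / D"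
    using \<open>0 < \<delta>0\<close> d A3 \<eta> D by (auto simp: \<delta>_def min_less_iff_disj)
  define \<Phi> where "\<Phi> x = x + \<delta> *\<^sub>R V x" for x
  \<comment> \<open>The bound \<open>A2\<close> holds on the closure only; the strict inequality
    with \<open>A2 + 1\<close> extends a bound to an open neighbourhood.\<close>
  define N where "N = \<Phi> -` B \<inter> (\<Inter>l\<in>{..<8}. {x. norm (W l x) < A2 + 1})"
  define G where "G l x = (\<Sum>k<8. ocomp (ebas l + \<delta> *\<^sub>R W l x) k *\<^sub>R g k (\<Phi> x))" for l x
  have c\<Phi>: "continuous_on S \<Phi>" for S
    unfolding \<Phi>_def using continuous_on_subset[OF V(2) subset_UNIV] by (intro continuous_intros) auto
  have "open N"
    unfolding N_def
  proof (intro open_Int open_INT ballI)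
    show "open (\<Phi> -` B)" using opB c\<Phi> by (rule open_vimage)
    show "open {x. norm (W l x) < A2 + 1}" if "l \<in> {..<8}" for l
      using cW that by (intro open_Collect_less continuous_intros) auto
  qed auto
  moreover have "closure B \<subseteq> N"
    using push[OF \<delta>(1,2)] A2(2) by (force simp: N_def \<Phi>_def)
  moreover have "has_partials N (\<lambda>x. f (\<Phi> x)) G"
    unfolding has_partials_def
  proof (intro allI impI conjI ballI)
    fix l :: nat assume l: "l < 8"
    have "continuous_on N (\<lambda>x. g k (\<Phi> x))" if "k < 8" for k
      using continuous_on_compose2[OF _ c\<Phi>, of B "g k" N] f that
      unfolding has_partials_def N_def by blast
    then show "continuous_on N (G l)"
      unfolding G_def ocomp_def using cW[OF l, of N] by (intro continuous_intros) auto
    fix x assume x: "x \<in> N"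
    have xB: "\<Phi> x \<in> B" using x by (simp add: N_def)
    let ?v = "ebas l + \<delta> *\<^sub>R W l x"
    have "((\<lambda>t. V (x + t *\<^sub>R ebas l)) has_vector_derivative W l x) (at 0)"
      using V(1) l unfolding has_partials_def by blast
    then have path: "((\<lambda>t. \<Phi> (x + t *\<^sub>R ebas l)) has_derivative (\<lambda>t. t *\<^sub>R ?v)) (at 0)"
      unfolding \<Phi>_def has_vector_derivative_def
      by (auto intro!: derivative_eq_intros simp: algebra_simps)
    have fd: "(f has_derivative (\<lambda>v. \<Sum>k<8. ocomp v k *\<^sub>R g k (\<Phi> x))) (at (\<Phi> x))"
      using partials_has_derivative[OF opB f xB] .
    then have "(f has_derivative (\<lambda>v. \<Sum>k<8. ocomp v k *\<^sub>R g k (\<Phi> x))) (at (\<Phi> (x + 0 *\<^sub>R ebas l)))"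
      by simp
    from diff_chain_at[OF path this]
    show "((\<lambda>t. f (\<Phi> (x + t *\<^sub>R ebas l))) has_vector_derivative G l x) (at 0)"
      unfolding has_vector_derivative_def G_def o_def
      by (simp add: ocomp_def scaleR_sum_right)
  qed
  moreover have "norm (\<Sum>l<8. omult (ebas l) (G l x)) \<le> \<eta>" if x: "x \<in> N" for x
  proof -
    have xB: "\<Phi> x \<in> B" using x by (simp add: N_def)
    then have xC: "\<Phi> x \<in> closure B" using closure_subset by blast
    define H where "H l = (\<Sum>k<8. ocomp (W l x) k *\<^sub>R g k (\<Phi> x))" for l
    have G_eq: "G l x = g l (\<Phi> x) + \<delta> *\<^sub>R H l" if l: "l < 8" for l
    proof -
      have "(\<Sum>k<8. ocomp (ebas l) k *\<^sub>R g k (\<Phi> x)) = (\<Sum>k<8. if l = k then g k (\<Phi> x) else 0)"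
        using l by (intro sum.cong refl) (simp add: ocomp_ebas)
      also have "\<dots> = g l (\<Phi> x)" using l by simp
      finally show ?thesis
        by (simp add: G_def H_def ocomp_def scaleR_left_distrib sum.distrib scaleR_sum_right)
    qed
    have H: "norm (H l) \<le> 8 * ((A2 + 1) * A1)" if l: "l < 8" for l
    proof -
      have "norm (H l) \<le> (\<Sum>k<(8::nat). (A2 + 1) * A1)"
        unfolding H_def
      proof (rule sum_norm_le)
        fix k :: nat assume k: "k \<in> {..<8}"
        have "\<bar>ocomp (W l x) k\<bar> \<le> A2 + 1"
          using abs_ocomp_le[of "W l x" k] x l by (force simp: N_def)
        then show "norm (ocomp (W l x) k *\<^sub>R g k (\<Phi> x)) \<le> (A2 + 1) * A1"
          using A1 A2 k xC by (simp add: mult_mono)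
      qed
      then show ?thesis by simp
    qed
    have "(\<Sum>l<8. omult (ebas l) (G l x)) = (\<Sum>l<8. omult (ebas l) (g l (\<Phi> x)) + \<delta> *\<^sub>R omult (ebas l) (H l))"
      by (intro sum.cong refl) (simp add: G_eq linear_add[OF omult_linear] linear_scale[OF omult_linear])
    also have "\<dots> = \<delta> *\<^sub>R (\<Sum>l<8. omult (ebas l) (H l))"
      using Df[OF xB] by (simp add: sum.distrib scaleR_sum_right)
    finally have "norm (\<Sum>l<8. omult (ebas l) (G l x)) = \<delta> * norm (\<Sum>l<8. omult (ebas l) (H l))"
      using \<delta> by simp
    also have "norm (\<Sum>l<8. omult (ebas l) (H l)) \<le> (\<Sum>l<(8::nat). c * (8 * ((A2 + 1) * A1)))"
    proof (rule sum_norm_le)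
      fix l :: nat assume "l \<in> {..<8}"
      then have l: "l < 8" by simp
      show "norm (omult (ebas l) (H l)) \<le> c * (8 * ((A2 + 1) * A1))"
        using c(2)[OF l, of "H l"] mult_left_mono[OF H[OF l], of c] c(1) by linarith
    qed
    also have "\<dots> = D" by (simp add: D_def)
    also have "\<delta> * D \<le> \<eta>" using \<delta>(4) D by (simp add: pos_le_divide_eq)
    finally show ?thesis using \<delta>(1) by (simp add: mult_left_mono)
  qed
  moreover have "norm (f (\<Phi> x) - f x) \<le> \<eta>" if x: "x \<in> B" for x
  proof -
    have xC: "x \<in> closure B" using x closure_subset by blast
    then have "\<Phi> x \<in> closure B" using push[OF \<delta>(1,2)] closure_subset by (auto simp: \<Phi>_def)
    moreover have "dist (\<Phi> x) x < d"
    proof -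
      have "dist (\<Phi> x) x = \<delta> * norm (V x)" using \<delta> by (simp add: \<Phi>_def dist_norm)
      also have "\<dots> \<le> \<delta> * A3" using A3(2)[OF xC] \<delta> by (intro mult_left_mono) auto
      also have "\<dots> \<le> d / (2 * A3) * A3" using \<delta> A3 by (intro mult_right_mono) auto
      also have "\<dots> < d" using A3 d by simp
      finally show ?thesis .
    qed
    ultimately show ?thesis using d(2)[OF xC] by (simp add: dist_norm less_imp_le)
  qed
  ultimately show ?thesis by blast
qed

subsection \<open>The approximation theorem\<close>

text \<open>For each \<open>h\<close> a \<open>w\<close> is taken whose error is within
  \<open>h\<close> of the infimum of the attainable ones. Where no error level is attainable,
  \<open>base\<close> keeps the exact condition \<open>A\<close>.\<close>

lemma diagonal_choice:
  fixes A :: "real \<Rightarrow> 'w \<Rightarrow> bool" and E :: "real \<Rightarrow> 'w \<Rightarrow> real \<Rightarrow> bool"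
  assumes ev: "\<And>\<epsilon>. 0 < \<epsilon> \<Longrightarrow> \<forall>\<^sub>F h in at_right 0. \<exists>w. A h w \<and> E h w \<epsilon>"
    and mono: "\<And>h w \<epsilon> \<epsilon>'. E h w \<epsilon> \<Longrightarrow> \<epsilon> \<le> \<epsilon>' \<Longrightarrow> E h w \<epsilon>'"
    and A0: "\<And>h. A h base"
  shows "\<exists>W. (\<forall>h. A h (W h)) \<and> (\<forall>\<epsilon>>0. \<forall>\<^sub>F h in at_right 0. E h (W h) \<epsilon>)"
proof -
  define S where "S h = {\<eta>. 0 < \<eta> \<and> (\<exists>w. A h w \<and> E h w \<eta>)}" for h
  have bdd: "bdd_below (S h)" for h by (rule bdd_belowI[of _ 0]) (auto simp: S_def)
  have "\<exists>w. A h w \<and> (0 < h \<and> S h \<noteq> {} \<longrightarrow> (\<exists>\<eta> < Inf (S h) + h. E h w \<eta>))" for h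
  proof (cases "0 < h \<and> S h \<noteq> {}")
    case True
    then have "\<exists>\<eta>\<in>S h. \<eta> < Inf (S h) + h" by (intro cInf_lessD) auto
    then show ?thesis by (auto simp: S_def)
  qed (use A0 in auto)
  then obtain W where W: "\<And>h. A h (W h)"
    "\<And>h. 0 < h \<Longrightarrow> S h \<noteq> {} \<Longrightarrow> \<exists>\<eta> < Inf (S h) + h. E h (W h) \<eta>" by metis
  have "\<forall>\<^sub>F h in at_right 0. E h (W h) \<epsilon>" if \<epsilon>: "0 < \<epsilon>" for \<epsilon>
  proof -
    have e2: "0 < \<epsilon> / 2" using \<epsilon> by simp
    have small: "\<forall>\<^sub>F h in at_right 0. 0 < h \<and> h < \<epsilon> / 2"
      unfolding eventually_at_right_field using e2 by (intro exI[of _ "\<epsilon> / 2"]) auto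
    show ?thesis
      using ev[OF e2] small
    proof eventually_elim
      case (elim h)
      then have "\<epsilon> / 2 \<in> S h" using e2 by (auto simp: S_def)
      then have "Inf (S h) \<le> \<epsilon> / 2" using bdd by (rule cInf_lower)
      moreover have "S h \<noteq> {}" using \<open>\<epsilon> / 2 \<in> S h\<close> by blast
      then obtain \<eta> where "\<eta> < Inf (S h) + h" "E h (W h) \<eta>" using W(2) elim by blast
      ultimately show ?case using mono[of h "W h" \<eta> \<epsilon>] elim by linarith
    qed
  qed
  with W(1) show ?thesis by blast
qed

lemma Dh_diff: "Dh h (\<lambda>x. u x - v x) x = Dh h u x - Dh h v x"
proof -
  have "Dh h (\<lambda>x. u x - v x) x
    = (\<Sum>l<8. omult (ebas l) ((1 / (2 * h)) *\<^sub>R (u (x + h *\<^sub>R ebas l) - u (x - h *\<^sub>R ebas l))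
        - (1 / (2 * h)) *\<^sub>R (v (x + h *\<^sub>R ebas l) - v (x - h *\<^sub>R ebas l))))"
    unfolding Dh_def
    by (intro sum.cong refl arg_cong[where f = "omult _"]) (simp only: scaleR_right_diff_distrib diff_diff_eq2 diff_diff_eq add.commute diff_add_eq, simp add: algebra_simps)
  then show ?thesis
    unfolding Dh_def linear_diff[OF omult_linear] by (simp only: sum_subtractf)
qed

theorem mainTheorem18:
  fixes B :: "(real^8) set" and Bh :: "real \<Rightarrow> (real^8) set" and f :: "real^8 \<Rightarrow> real^8"
  assumes "C3_domain B"
    and "\<forall>h>0. Bh h \<subseteq> lattice h"
    and "approx_O2 Bh B"
    and "Ck 3 B (closure B) f"
    and "\<forall>x\<in>B. Dirac f x = 0"
  shows "\<exists>fh :: real \<Rightarrow> real^8 \<Rightarrow> real^8.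
           (\<forall>h>0. \<forall>x\<in>dint h (Bh h). Dh h (fh h) x = 0) \<and>
           (\<forall>\<epsilon>>0. eventually (\<lambda>h. \<forall>x\<in>Bh h \<inter> B. norm (f x - fh h x) < \<epsilon>) (at_right 0))"
proof -
  have cB: "compact (closure B)" and ne: "closure B \<noteq> {}"
    using assms(1) by (auto simp: C3_domain_def compact_closure)
  have conv: "disc_converges Bh B" using assms(3) by (simp add: approx_O2_def)
  have cf: "continuous_on (closure B) f" using assms(4) by (rule Ck_continuous)
  obtain g where g: "has_partials B f g" "\<And>l. l < 8 \<Longrightarrow> continuous_on (closure B) (g l)"
    using Ck_has_partials[of 2 B "closure B" f] assms(4) closure_subset
    by (auto simp: numeral_3_eq_3 numeral_2_eq_2)
  have "pd l f x = g l x" if "l < 8" "x \<in> B" for l x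
    using g(1) that unfolding has_partials_def pd_def by (intro vector_derivative_at) blast
  then have Df: "(\<Sum>l<8. omult (ebas l) (g l x)) = 0" if "x \<in> B" for x
    using assms(5) that by (simp add: Dirac_def)
  obtain r where r: "r > 0" "\<And>x. x \<in> closure B \<Longrightarrow> norm x \<le> r"
    using compact_imp_bounded[OF cB] by (auto simp: bounded_pos)
  obtain C where C: "C > 0" "\<And>h g G. 0 < h \<Longrightarrow> h \<le> 1/4 \<Longrightarrow> 0 < G \<Longrightarrow> (\<And>x. norm (g x) \<le> G) \<Longrightarrow>
      \<exists>w. \<forall>x. norm x < r + 1 \<longrightarrow> Dh h w x = g x \<and> norm (w x) \<le> C * G"
    using Dh_right_inverse[of "r + 1"] r(1) by auto
  have "\<forall>\<^sub>F h in at_right 0. \<exists>w. (\<forall>x\<in>dint h (Bh h). Dh h w x = 0) \<and> (\<forall>x\<in>Bh h \<inter> B. norm (f x - w x) < \<epsilon>)"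
    if \<epsilon>: "0 < \<epsilon>" for \<epsilon>
  proof -
    \<comment> \<open>The error is \<eta> from the translation plus C * 2 \<eta> from the
      correction, in total \<eta> D = \<epsilon>/2.\<close>
    define D where "D = 1 + 2 * C"
    have D: "0 < D" using C(1) by (simp add: D_def)
    define \<eta> where "\<eta> = \<epsilon> / (2 * D)"
    have \<eta>: "0 < \<eta>" "\<eta> + C * (2 * \<eta>) < \<epsilon>"
    proof -
      show "0 < \<eta>" using \<epsilon> D by (simp add: \<eta>_def)
      have "\<eta> + C * (2 * \<eta>) = \<eta> * D" by (simp add: D_def algebra_simps)
      also have "\<dots> = \<epsilon> / 2" using D by (simp add: \<eta>_def)
      finally show "\<eta> + C * (2 * \<eta>) < \<epsilon>" using \<epsilon> by simp
    qed
    obtain F G N where N: "open N" "closure B \<subseteq> N" and F: "has_partials N F G"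
      and small: "\<And>x. x \<in> N \<Longrightarrow> norm (\<Sum>l<8. omult (ebas l) (G l x)) \<le> \<eta>"
      and Ff: "\<And>x. x \<in> B \<Longrightarrow> norm (F x - f x) \<le> \<eta>"
      using regular_approximation[OF assms(1) cf g Df \<eta>(1)] by blast
    obtain \<rho> h0 where \<rho>: "\<rho> > 0" "h0 > 0"
      "\<And>h x. 0 < h \<Longrightarrow> h < h0 \<Longrightarrow> infdist x (closure B) \<le> \<rho> \<Longrightarrow> norm (Dh h F x) \<le> 2 * \<eta>"
      using Dh_near_Dirac[OF cB ne N F \<eta>(1) small] by blast
    have "0 < min \<rho> 1" using \<rho> by simp
    then have "\<forall>\<^sub>F h in at_right 0. \<forall>a\<in>Bh h. \<exists>b\<in>closure B. dist a b < min \<rho> 1"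
      using conv[unfolded disc_converges_def, rule_format, of "min \<rho> 1"] by (simp only: eventually_conj_iff)
    moreover have "\<forall>\<^sub>F h in at_right 0. 0 < h \<and> h < min h0 (1/4)"
      unfolding eventually_at_right_field using \<rho> by (intro exI[of _ "min h0 (1/4)"]) auto
    ultimately show ?thesis
    proof eventually_elim
      case (elim h)
      \<comment> \<open>The right inverse expects a bound on all of R^8. Cutting off beyond distance
        \<rho> provides it and changes nothing on \<open>Bh h\<close>.\<close>
      define q where "q x = (if infdist x (closure B) \<le> \<rho> then Dh h F x else 0)" for x
      have "norm (q x) \<le> 2 * \<eta>" for x using \<rho>(3)[of h x] elim \<eta>(1) by (auto simp: q_def)
      then obtain w where w: "\<And>x. norm x < r + 1 \<Longrightarrow> Dh h w x = q x \<and> norm (w x) \<le> C * (2 * \<eta>)"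
        using C(2)[of h "2 * \<eta>" q] elim \<eta>(1) by auto
      have near: "norm x < r + 1" "infdist x (closure B) \<le> \<rho>" if x: "x \<in> Bh h" for x
      proof -
        obtain b where b: "b \<in> closure B" "dist x b < min \<rho> 1" using elim x by blast
        then show "infdist x (closure B) \<le> \<rho>" using infdist_le[OF b(1), of x] by simp
        show "norm x < r + 1"
          using norm_triangle_sub[of x b] r(2)[OF b(1)] b(2) by (simp add: dist_norm)
      qed
      have "Dh h (\<lambda>x. F x - w x) x = 0" if "x \<in> dint h (Bh h)" for x
      proof -
        have "x \<in> Bh h" using that by (simp add: dint_def)
        then show ?thesis using near[of x] w[of x] by (simp add: Dh_diff q_def)
      qed
      moreover have "norm (f x - (F x - w x)) < \<epsilon>" if "x \<in> Bh h \<inter> B" for x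
      proof -
        have "f x - (F x - w x) = w x - (F x - f x)" by simp
        then have "norm (f x - (F x - w x)) \<le> norm (w x) + norm (F x - f x)"
          by (metis norm_triangle_ineq4)
        also have "\<dots> \<le> C * (2 * \<eta>) + \<eta>" using w[of x] near[of x] Ff[of x] that by (intro add_mono) auto
        finally show ?thesis using \<eta>(2) by linarith
      qed
      ultimately show ?case by (intro exI[of _ "\<lambda>x. F x - w x"]) blast
    qed
  qed
  then have "\<exists>W. (\<forall>h. \<forall>x\<in>dint h (Bh h). Dh h (W h) x = 0) \<and>
    (\<forall>\<epsilon>>0. \<forall>\<^sub>F h in at_right 0. \<forall>x\<in>Bh h \<inter> B. norm (f x - W h x) < \<epsilon>)"
    \<comment> \<open>The zero function is discretely regular for every \<open>h\<close>.\<close>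
    by (rule diagonal_choice[where base = "\<lambda>_. 0"])
      (auto simp: Dh_def linear_0[OF omult_linear] intro: less_le_trans)
  then show ?thesis by blast
qed

end
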